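(* Let $\Phi=\{\phi_i\}_{i\in\mathcal{D}}$ be a conformal iterated function system containing an exact overlap, with attractor $X\subset\mathbb{R}^d$. Then there are no approximation regular pairs, i.e. for every $z\in X$ the pair $(\Phi,z)$ is not an approximation regular pair.
   Context: An iterated function system (IFS) is a finite family of contractions $\Phi=\{\phi_i\}_{i\in\mathcal{D}}$ of a closed subset of $\mathbb{R}^d$ into itself; its attractor is the unique non-empty compact set $X$ with $X=\bigcup_{i\in\mathcal{D}}\phi_i(X)$. Write $\mathcal{D}^n$ for words of length $n$ over $\mathcal{D}$, $\mathcal{D}^*=\bigcup_{n\ge1}\mathcal{D}^n$; for $I=(i_1,\dots,i_n)$, $|I|=n$, $\phi_I=\phi_{i_1}\circ\cdots\circ\phi_{i_n}$, $X_I=\phi_I(X)$. $\dim_H$ and $\mathcal{H}^s$ denote Hausdorff dimension and $s$-dimensional Hausdorff measure, $Diam$ denotes diameter, $B(x,r)$ is the closed Euclidean ball of centre $x$ and radius $r$. Exact overlap: there exist $n\in\mathbb{N}$ and distinct words $I,J\in\mathcal{D}^n$ with $\phi_I=\phi_J$. Conformal IFS: an IFS $\Phi$ on a compact set $Y\subset\mathbb{R}^d$ such that each $\phi_i$ extends to an injective conformal contraction on some open connected neighbourhood $V$ of $Y$ (conformal: $C^1$ with $|\phi_i'(x)y|=|\phi_i'(x)||y|$ for all $x\in V$, $y\in\mathbb{R}^d$), with $0<\inf_{x\in V}|\phi_i'(x)|\le\sup_{x\in V}|\phi_i'(x)|<1$, and such that for some $\alpha,c>0$, $||\phi_i'(x)|-|\phi_i'(y)||\le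 c|x-y|^\alpha$ for all $x,y\in V$, $i\in\mathcal{D}$. Similarity dimension $\dim_S(X)$ of a conformal IFS $\Phi$ (it depends on $\Phi$): the unique $s\in\mathbb{R}$ with $P(s)=0$, where $P(s)=\lim_{n\to\infty}\frac1n\log\inf_{x\in X}\sum_{I\in\mathcal{D}^n}|\phi_I'(x)|^s=\lim_{n\to\infty}\frac1n\log\sup_{x\in X}\sum_{I\in\mathcal{D}^n}|\phi_I'(x)|^s$. For $z\in X$ and $\Psi:\mathcal{D}^*\to\mathbb{R}_{\ge0}$, $W(\Psi,z):=\{x\in X: x\in B(\phi_I(z),\Psi(I))\text{ for infinitely many } I\in\mathcal{D}^*\}$. Approximation regular pairs (it is implicit that $\dim_H(X)>0$): for $\theta:\mathbb{N}\to\mathbb{R}_{\ge0}$ put $\Psi_\theta(I)=Diam(X_I)^{\dim_S(X)/\dim_H(X)}\theta(|I|)$, and consider the divergence condition $$(\ast)\quad\sum_{n=1}^\infty\sum_{I\in\mathcal{D}^n}\big(Diam(X_I)^{\dim_S(X)/\dim_H(X)}\theta(n)\big)^{\dim_H(X)}=\infty.$$ If $\mathcal{H}^{\dim_H(X)}(X)>0$, then $(\Phi,z)$, $z\in X$, is an approximation regular pair if for every decreasing (i.e. non-increasing) $\theta:\mathbb{N}\to\mathbb{R}_{\ge0}$ satisfying $(\ast)$, $\mathcal{H}^{\dim_H(X)}$-almost every $x\in X$ lies in $W(\Psi_\theta,z)$. If $\mathcal{H}^{\dim_H(X)}(X)=0$, then $(\Phi,z)$ is an approximation regular pair if for every decreasing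 $\theta:\mathbb{N}\to\mathbb{R}_{\ge0}$ satisfying $(\ast)$, $\dim_H(W(\Psi_\theta,z))=\dim_H(X)$. *)

theory Defs
  imports "HOL-Analysis.Analysis"
begin

section \<open>Hausdorff measure and Hausdorff dimension\<close>

text \<open>
  The contribution of one covering set, with the usual conventions \<open>diam({})^s = 0\<close> and
  \<open>0^0 = 1\<close>, so that the measure for \<open>s = 0\<close> is counting measure.  The convention at
  \<open>s = 0\<close> is made explicit because \<open>0 powr 0 = 0\<close> in the library.
\<close>

definition diam_pow :: "real \<Rightarrow> 'a::metric_space set \<Rightarrow> real" where
  "diam_pow s U = (if U = {} then 0 else if s = 0 then 1 else diameter U powr s)"

text \<open>
  Covering sets are required to be bounded because the value of \<^const>\<open>diameter\<close> carries no
  information for unbounded sets.  The infimum over an empty family of covers is \<open>\<infinity>\<close>.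
\<close>

definition hausdorff_premeasure :: "real \<Rightarrow> real \<Rightarrow> 'a::metric_space set \<Rightarrow> ennreal" where
  "hausdorff_premeasure s \<delta> A =
     (INF U \<in> {U :: nat \<Rightarrow> 'a set. A \<subseteq> (\<Union>i. U i) \<and> (\<forall>i. bounded (U i) \<and> diameter (U i) \<le> \<delta>)}.
        \<Sum>i. ennreal (diam_pow s (U i)))"

definition hausdorff_measure :: "real \<Rightarrow> 'a::metric_space set \<Rightarrow> ennreal" where
  "hausdorff_measure s A = (SUP \<delta> \<in> {0<..}. hausdorff_premeasure s \<delta> A)"

text \<open>
  The restriction to Euclidean spaces makes a real-valued dimension adequate: every exponent
  above \<open>DIM('a)\<close> belongs to the set below.  The empty set has dimension \<open>0\<close>.
\<close>

definition hausdorff_dim :: "'a::euclidean_space set \<Rightarrow> real" where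
  "hausdorff_dim A = Inf {s. 0 \<le> s \<and> hausdorff_measure s A = 0}"


section \<open>Conformal iterated function systems\<close>

definition contraction_on :: "'a::metric_space set \<Rightarrow> ('a \<Rightarrow> 'a) \<Rightarrow> bool" where
  "contraction_on S f \<longleftrightarrow> (\<exists>r<1. lipschitz_on r S f)"

definition ifs :: "'i set \<Rightarrow> ('i \<Rightarrow> 'a \<Rightarrow> 'a) \<Rightarrow> 'a::euclidean_space set \<Rightarrow> bool" where
  "ifs D \<phi> Y \<longleftrightarrow> finite D \<and> closed Y \<and> (\<forall>i\<in>D. \<phi> i ` Y \<subseteq> Y \<and> contraction_on Y (\<phi> i))"

definition is_attractor :: "'i set \<Rightarrow> ('i \<Rightarrow> 'a \<Rightarrow> 'a) \<Rightarrow> 'a::euclidean_space set \<Rightarrow> 'a set \<Rightarrow> bool" where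
  "is_attractor D \<phi> Y X \<longleftrightarrow> X \<noteq> {} \<and> compact X \<and> X \<subseteq> Y \<and> X = (\<Union>i\<in>D. \<phi> i ` X)"

definition words :: "'i set \<Rightarrow> nat \<Rightarrow> 'i list set" where
  "words D n = {I. set I \<subseteq> D \<and> length I = n}"

definition all_words :: "'i set \<Rightarrow> 'i list set" where
  "all_words D = (\<Union>n\<in>{1..}. words D n)"

definition word_map :: "('i \<Rightarrow> 'a \<Rightarrow> 'a) \<Rightarrow> 'i list \<Rightarrow> 'a \<Rightarrow> 'a" where
  "word_map \<phi> I = foldr (\<lambda>i f. \<phi> i \<circ> f) I id"

text \<open>The maps \<open>\<phi>\<^sub>i\<close> are self-maps of \<open>Y\<close>, so equality of maps is equality on \<open>Y\<close>.\<close>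

definition exact_overlap :: "'i set \<Rightarrow> ('i \<Rightarrow> 'a \<Rightarrow> 'a) \<Rightarrow> 'a set \<Rightarrow> bool" where
  "exact_overlap D \<phi> Y \<longleftrightarrow>
     (\<exists>n\<ge>1. \<exists>I\<in>words D n. \<exists>J\<in>words D n. I \<noteq> J \<and> (\<forall>x\<in>Y. word_map \<phi> I x = word_map \<phi> J x))"

definition conformal_on :: "'a::euclidean_space set \<Rightarrow> ('a \<Rightarrow> 'a) \<Rightarrow> bool" where
  "conformal_on V f \<longleftrightarrow>
     (\<exists>f' :: 'a \<Rightarrow> 'a \<Rightarrow>\<^sub>L 'a. continuous_on V f' \<and>
        (\<forall>x\<in>V. (f has_derivative blinfun_apply (f' x)) (at x) \<and>
               (\<forall>y. norm (blinfun_apply (f' x) y) = norm (f' x) * norm y)))"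

definition deriv_norm :: "('a \<Rightarrow> 'a) \<Rightarrow> 'a::euclidean_space \<Rightarrow> real" where
  "deriv_norm f x = onorm (frechet_derivative f (at x))"

text \<open>
  Each \<open>\<phi> i\<close> is a total function that stands at once for the contraction of \<open>Y\<close> and for its
  conformal extension to the neighbourhood \<open>V\<close>; its values outside \<open>V\<close> play no role.  The
  extension is not required to map \<open>V\<close> into itself.
\<close>

definition conformal_ifs :: "'i set \<Rightarrow> ('i \<Rightarrow> 'a \<Rightarrow> 'a) \<Rightarrow> 'a::euclidean_space set \<Rightarrow> bool" where
  "conformal_ifs D \<phi> Y \<longleftrightarrow>
     ifs D \<phi> Y \<and> compact Y \<and>
     (\<exists>V. open V \<and> connected V \<and> Y \<subseteq> V \<and>
        (\<forall>i\<in>D. inj_on (\<phi> i) V \<and> contraction_on V (\<phi> i) \<and> conformal_on V (\<phi> i) \<and>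
               0 < (INF x\<in>V. deriv_norm (\<phi> i) x) \<and>
               bdd_above (deriv_norm (\<phi> i) ` V) \<and> (SUP x\<in>V. deriv_norm (\<phi> i) x) < 1) \<and>
        (\<exists>\<alpha>>0. \<exists>c>0. \<forall>i\<in>D. \<forall>x\<in>V. \<forall>y\<in>V.
            \<bar>deriv_norm (\<phi> i) x - deriv_norm (\<phi> i) y\<bar> \<le> c * dist x y powr \<alpha>))"


section \<open>Pressure and similarity dimension\<close>

definition pressure_sum :: "'i set \<Rightarrow> ('i \<Rightarrow> 'a \<Rightarrow> 'a) \<Rightarrow> real \<Rightarrow> nat \<Rightarrow> 'a::euclidean_space \<Rightarrow> real" where
  "pressure_sum D \<phi> s n x = (\<Sum>I\<in>words D n. deriv_norm (word_map \<phi> I) x powr s)"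

text \<open>
  \<open>has_pressure D \<phi> X s p\<close> states \<open>P(s) = p\<close>: both defining limits exist and are equal to \<open>p\<close>.
\<close>

definition has_pressure ::
    "'i set \<Rightarrow> ('i \<Rightarrow> 'a \<Rightarrow> 'a) \<Rightarrow> 'a::euclidean_space set \<Rightarrow> real \<Rightarrow> real \<Rightarrow> bool" where
  "has_pressure D \<phi> X s p \<longleftrightarrow>
     (\<lambda>n. 1 / real n * ln (INF x\<in>X. pressure_sum D \<phi> s n x)) \<longlonglongrightarrow> p \<and>
     (\<lambda>n. 1 / real n * ln (SUP x\<in>X. pressure_sum D \<phi> s n x)) \<longlonglongrightarrow> p"

definition similarity_dim :: "'i set \<Rightarrow> ('i \<Rightarrow> 'a \<Rightarrow> 'a) \<Rightarrow> 'a::euclidean_space set \<Rightarrow> real" where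
  "similarity_dim D \<phi> X = (THE s. has_pressure D \<phi> X s 0)"


section \<open>Approximation regular pairs\<close>

definition limsup_set ::
    "'i set \<Rightarrow> ('i \<Rightarrow> 'a \<Rightarrow> 'a) \<Rightarrow> 'a::euclidean_space set \<Rightarrow> ('i list \<Rightarrow> real) \<Rightarrow> 'a \<Rightarrow> 'a set" where
  "limsup_set D \<phi> X \<Psi> z =
     {x\<in>X. infinite {I \<in> all_words D. x \<in> cball (word_map \<phi> I z) (\<Psi> I)}}"

definition approx_radius ::
    "'i set \<Rightarrow> ('i \<Rightarrow> 'a \<Rightarrow> 'a) \<Rightarrow> 'a::euclidean_space set \<Rightarrow> (nat \<Rightarrow> real) \<Rightarrow> 'i list \<Rightarrow> real" where
  "approx_radius D \<phi> X \<theta> I =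
     diameter (word_map \<phi> I ` X) powr (similarity_dim D \<phi> X / hausdorff_dim X) * \<theta> (length I)"

text \<open>The sum over word lengths starts at \<open>1\<close>, hence the shift by \<^const>\<open>Suc\<close>.\<close>

definition divergence_condition ::
    "'i set \<Rightarrow> ('i \<Rightarrow> 'a \<Rightarrow> 'a) \<Rightarrow> 'a::euclidean_space set \<Rightarrow> (nat \<Rightarrow> real) \<Rightarrow> bool" where
  "divergence_condition D \<phi> X \<theta> \<longleftrightarrow>
     (\<Sum>n. \<Sum>I\<in>words D (Suc n). ennreal (approx_radius D \<phi> X \<theta> I powr hausdorff_dim X)) = \<infinity>"

text \<open>
  The notion presupposes \<open>hausdorff_dim X > 0\<close>, since the exponent in \<^const>\<open>approx_radius\<close>
  divides by it; this is part of the definition.  \<open>\<theta>\<close> is given on all of \<^typ>\<open>nat\<close>, but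
  \<open>\<theta> 0\<close> is never used.  ``Almost every'' is expressed by nullity of the
  complement for the outer measure \<^const>\<open>hausdorff_measure\<close>.
\<close>

definition approx_regular_pair ::
    "'i set \<Rightarrow> ('i \<Rightarrow> 'a \<Rightarrow> 'a) \<Rightarrow> 'a::euclidean_space set \<Rightarrow> 'a \<Rightarrow> bool" where
  "approx_regular_pair D \<phi> X z \<longleftrightarrow>
     hausdorff_dim X > 0 \<and> z \<in> X \<and>
     (\<forall>\<theta> :: nat \<Rightarrow> real. (\<forall>n. 0 \<le> \<theta> n) \<and> decseq \<theta> \<and> divergence_condition D \<phi> X \<theta> \<longrightarrow>
        (let W = limsup_set D \<phi> X (approx_radius D \<phi> X \<theta>) z in
         if hausdorff_measure (hausdorff_dim X) X > 0
         then hausdorff_measure (hausdorff_dim X) (X - W) = 0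
         else hausdorff_dim W = hausdorff_dim X))"

end

theory Submission
  imports Defs
begin

text \<open>
  Write \<open>s\<close> for the similarity dimension, \<open>d > 0\<close> for the Hausdorff dimension of \<open>X\<close>, and take
  \<open>\<theta> = 1\<close>, so that the ball attached to a word \<open>I\<close> has radius \<open>diam(X\<^sub>I)\<^bsup>s/d\<^esup>\<close>.  The divergence
  condition then asks for \<open>\<Sum>\<^sub>n \<Sum>\<^sub>I diam(X\<^sub>I)\<^sup>s = \<infinity>\<close>.  It holds, because \<open>diam(X\<^sub>I)\<close> is comparable to
  \<open>|\<phi>\<^sub>I'|\<close> and zero pressure together with bounded distortion keeps every level sum
  \<open>\<Sum>\<^bsub>|I| = n\<^esub> |\<phi>\<^sub>I'|\<^sup>s\<close> between two positive constants.

  The ball of a word depends only on the map \<open>\<phi>\<^sub>I\<close>, and an exact overlap \<open>\<phi>\<^sub>J = \<phi>\<^sub>J\<^sub>'\<close> with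
  \<open>|J| = |J'| = k\<close> makes many maps coincide.  Cut a word into blocks of length \<open>k\<close> and replace each
  block \<open>J\<close> by \<open>J'\<close>: the words without a block \<open>J\<close> already give all maps of their level.  Forbidding
  a block costs a fixed proportion of the mass at every step, so the sum of \<open>|\<phi>\<^sub>I'|\<^sup>s\<close> over these words
  decays exponentially in the length (lemma \<open>reduced_decay\<close>).  Since \<open>|\<phi>\<^sub>I'|\<close> is bounded
  below by an exponential in \<open>|I|\<close>, the decay survives when the exponent is lowered slightly below \<open>s\<close>
  (lemma \<open>representatives_summable\<close>).  By the Hausdorff-Cantelli argument
  (lemma \<open>hausdorff_measure_limsup_null\<close>) the limsup set \<open>W\<close> is null for the \<open>d\<close>-dimensional measure
  and for some smaller exponent.  So \<open>W\<close> has dimension below \<open>d\<close>, and it cannot have full measure in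
  \<open>X\<close> when \<open>X\<close> has positive measure; both alternatives in the definition of a regular pair fail.

  Two ingredients have to be supplied.  The similarity dimension is defined as the unique zero of the
  pressure; lemma \<open>critical_exponent_exists\<close> produces a zero directly as the exponent at which the
  level sums change from large to small, which yields the two-sided bounds at the same time.  The
  comparison of \<open>diam(X\<^sub>I)\<close> with \<open>|\<phi>\<^sub>I'|\<close> needs a lower Lipschitz bound for an injective conformal
  map; lemma \<open>conformal_expansion\<close> obtains it by showing that the image of a ball contains a ball of
  the expected radius.
\<close>

section \<open>Null sets of Hausdorff measures\<close>

lemma hausdorff_premeasure_le_cover:
  assumes "A \<subseteq> (\<Union>i. U i)" "\<And>i. bounded (U i)" "\<And>i. diameter (U i) \<le> \<delta>"
  shows "hausdorff_premeasure s \<delta> A \<le> (\<Sum>i. ennreal (diam_pow s (U i)))"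
  unfolding hausdorff_premeasure_def by (rule INF_lower) (use assms in auto)

lemma hausdorff_premeasure_less_cover:
  assumes "hausdorff_premeasure s \<delta> A < e"
  obtains U where "A \<subseteq> (\<Union>i. U i)" "\<And>i. bounded (U i)" "\<And>i. diameter (U i) \<le> \<delta>"
    "(\<Sum>i. ennreal (diam_pow s (U i))) < e"
  using assms unfolding hausdorff_premeasure_def INF_less_iff by auto

lemma hausdorff_premeasure_mono:
  assumes "A \<subseteq> B"
  shows "hausdorff_premeasure s \<delta> A \<le> hausdorff_premeasure s \<delta> B"
  unfolding hausdorff_premeasure_def by (rule INF_superset_mono) (use assms in auto)

lemma hausdorff_premeasure_single:
  assumes "bounded A" "diameter A \<le> \<delta>" "0 \<le> \<delta>"
  shows "hausdorff_premeasure s \<delta> A \<le> ennreal (diam_pow s A)"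
proof -
  have "hausdorff_premeasure s \<delta> A
      \<le> (\<Sum>i. ennreal (diam_pow s ((\<lambda>i::nat. if i = 0 then A else {}) i)))"
    by (rule hausdorff_premeasure_le_cover) (use assms in \<open>auto split: if_splits\<close>)
  also have "\<dots> = ennreal (diam_pow s A)"
    by (subst suminf_finite[of "{0}"]) (auto simp: diam_pow_def)
  finally show ?thesis .
qed

lemma hausdorff_premeasure_empty:
  "0 \<le> \<delta> \<Longrightarrow> hausdorff_premeasure s \<delta> {} = 0"
  using hausdorff_premeasure_single[of "{}" \<delta> s] by (simp add: diam_pow_def)

text \<open>
  Choose an almost optimal cover of each \<open>A n\<close> with error \<open>e / 2\<^bsup>n+1\<^esup>\<close> and enumerate all covering sets
  by pairs of indices.
\<close>

lemma hausdorff_premeasure_UN_le: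
  fixes A :: "nat \<Rightarrow> 'a::metric_space set"
  shows "hausdorff_premeasure s \<delta> (\<Union>n. A n) \<le> (\<Sum>n. hausdorff_premeasure s \<delta> (A n))"
proof (rule ennreal_le_epsilon)
  fix e :: real
  assume e: "0 < e" and fin: "(\<Sum>n. hausdorff_premeasure s \<delta> (A n)) < top"
  let ?H = "\<lambda>n. hausdorff_premeasure s \<delta> (A n)"
  let ?e = "\<lambda>n. ennreal (e * (1/2) ^ Suc n)"
  have "\<exists>U. A n \<subseteq> (\<Union>i. U i) \<and> (\<forall>i. bounded (U i) \<and> diameter (U i) \<le> \<delta>) \<and>
      (\<Sum>i. ennreal (diam_pow s (U i))) \<le> ?H n + ?e n" for n
  proof -
    have "?H n < top"
      using fin by (meson ennreal_suminf_lessD)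
    then have "?H n < ?H n + ?e n"
      using e by (simp add: ennreal_add_left_cancel_less flip: less_top)
    from hausdorff_premeasure_less_cover[OF this] show ?thesis
      by (metis less_imp_le)
  qed
  then obtain U where U: "\<And>n. A n \<subseteq> (\<Union>i. U n i)"
      "\<And>n i. bounded (U n i)" "\<And>n i. diameter (U n i) \<le> \<delta>"
      "\<And>n. (\<Sum>i. ennreal (diam_pow s (U n i))) \<le> ?H n + ?e n"
    by metis
  define V where "V = (\<lambda>k. U (fst (prod_decode k)) (snd (prod_decode k)))"
  have "hausdorff_premeasure s \<delta> (\<Union>n. A n) \<le> (\<Sum>k. ennreal (diam_pow s (V k)))"
  proof (rule hausdorff_premeasure_le_cover)
    show "(\<Union>n. A n) \<subseteq> (\<Union>k. V k)"
    proof
      fix x assume "x \<in> (\<Union>n. A n)"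
      then obtain n i where "x \<in> U n i" using U(1) by blast
      then have "x \<in> V (prod_encode (n, i))" by (simp add: V_def)
      then show "x \<in> (\<Union>k. V k)" by blast
    qed
  qed (unfold V_def, rule U(2), rule U(3))
  also have "\<dots> = (\<Sum>n. \<Sum>i. ennreal (diam_pow s (U n i)))"
    using suminf_ennreal_2dimen[of "\<lambda>n. \<Sum>i. ennreal (diam_pow s (U n i))"
        "\<lambda>p. ennreal (diam_pow s (U (fst p) (snd p)))"]
    by (simp add: comp_def V_def)
  also have "\<dots> \<le> (\<Sum>n. ?H n + ?e n)"
    by (rule suminf_le[OF U(4)]) auto
  also have "\<dots> = (\<Sum>n. ?H n) + (\<Sum>n. ?e n)"
    by (rule suminf_add[symmetric]) simp_all
  also have "(\<Sum>n. ?e n) = ennreal e"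
  proof (rule suminf_ennreal_eq)
    show "(\<lambda>n. e * (1/2) ^ Suc n) sums e"
      using sums_mult[OF power_half_series, of e] by simp
  qed (use e in auto)
  finally show "hausdorff_premeasure s \<delta> (\<Union>n. A n) \<le> (\<Sum>n. ?H n) + ennreal e" .
qed

lemma hausdorff_premeasure_Un_le:
  assumes "0 \<le> \<delta>"
  shows "hausdorff_premeasure s \<delta> (A \<union> B)
    \<le> hausdorff_premeasure s \<delta> A + hausdorff_premeasure s \<delta> B"
proof -
  let ?C = "\<lambda>n::nat. if n = 0 then A else if n = 1 then B else {}"
  have "A \<union> B = (\<Union>n. ?C n)"
    by (auto split: if_splits intro: exI[of _ 0] exI[of _ 1])
  then have "hausdorff_premeasure s \<delta> (A \<union> B) \<le> (\<Sum>n. hausdorff_premeasure s \<delta> (?C n))"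
    using hausdorff_premeasure_UN_le[of s \<delta> ?C] by simp
  also have "\<dots> = (\<Sum>n\<in>{0, 1}. hausdorff_premeasure s \<delta> (?C n))"
    by (rule suminf_finite) (auto simp: hausdorff_premeasure_empty assms)
  finally show ?thesis by simp
qed

lemma hausdorff_premeasure_finite_UN_le:
  assumes "finite F" "0 \<le> \<delta>"
  shows "hausdorff_premeasure s \<delta> (\<Union>I\<in>F. B I) \<le> (\<Sum>I\<in>F. hausdorff_premeasure s \<delta> (B I))"
  using assms(1)
proof (induction F)
  case (insert I F)
  have "hausdorff_premeasure s \<delta> (\<Union>J\<in>insert I F. B J)
      \<le> hausdorff_premeasure s \<delta> (B I) + hausdorff_premeasure s \<delta> (\<Union>J\<in>F. B J)"
    using hausdorff_premeasure_Un_le[OF assms(2)] by simp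
  also have "\<dots> \<le> (\<Sum>I\<in>insert I F. hausdorff_premeasure s \<delta> (B I))"
    using insert by (simp add: add_left_mono)
  finally show ?case .
qed (simp add: hausdorff_premeasure_empty assms(2))

lemma hausdorff_measure_eq_0_iff:
  "hausdorff_measure s A = 0 \<longleftrightarrow> (\<forall>\<delta>>0. hausdorff_premeasure s \<delta> A = 0)"
  unfolding hausdorff_measure_def bot_ennreal[symmetric] SUP_bot_conv by auto

lemma hausdorff_measure_null_Un:
  assumes "hausdorff_measure s A = 0" "hausdorff_measure s B = 0"
  shows "hausdorff_measure s (A \<union> B) = 0"
  unfolding hausdorff_measure_eq_0_iff
proof (intro allI impI)
  fix \<delta> :: real assume "\<delta> > 0"
  then show "hausdorff_premeasure s \<delta> (A \<union> B) = 0"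
    using hausdorff_premeasure_Un_le[of \<delta> s A B] assms
    by (simp add: hausdorff_measure_eq_0_iff)
qed

lemma hausdorff_measure_null_subset:
  assumes "hausdorff_measure s B = 0" "A \<subseteq> B"
  shows "hausdorff_measure s A = 0"
  using assms hausdorff_premeasure_mono[OF assms(2), of s]
  by (metis hausdorff_measure_eq_0_iff le_zero_eq)

lemma hausdorff_dim_le:
  assumes "0 \<le> t" "hausdorff_measure t A = 0"
  shows "hausdorff_dim A \<le> t"
  unfolding hausdorff_dim_def
  by (rule cInf_lower) (use assms in \<open>auto intro!: bdd_belowI[of _ 0]\<close>)

lemma hausdorff_dim_singleton_le: "hausdorff_dim {a::'a::euclidean_space} \<le> 0"
proof (rule field_le_epsilon)
  fix t :: real assume t: "0 < t"
  have "hausdorff_measure t {a} = 0"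
    unfolding hausdorff_measure_eq_0_iff
  proof (intro allI impI)
    fix \<delta> :: real assume "\<delta> > 0"
    then have "hausdorff_premeasure t \<delta> {a} \<le> ennreal (diam_pow t {a})"
      by (intro hausdorff_premeasure_single) auto
    then show "hausdorff_premeasure t \<delta> {a} = 0" using t by (simp add: diam_pow_def)
  qed
  then show "hausdorff_dim {a} \<le> 0 + t" using hausdorff_dim_le[of t] t by simp
qed

text \<open>
  The Hausdorff-Cantelli lemma: the tails of a summable family of covers of a limsup set are covers of
  arbitrarily small total cost.  The covering sets become small because their diameters to the power
  \<open>u > 0\<close> are bounded by the terms of a convergent series.
\<close>

lemma hausdorff_measure_limsup_null:
  fixes B :: "'b \<Rightarrow> 'a::metric_space set"
  assumes u: "0 < u"
    and fin: "\<And>n. finite (F n)"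
    and cover: "\<And>N. W \<subseteq> (\<Union>n\<in>{N..}. \<Union>I\<in>F n. B I)"
    and bdd: "\<And>n I. I \<in> F n \<Longrightarrow> bounded (B I)"
    and sm: "summable (\<lambda>n. \<Sum>I\<in>F n. diameter (B I) powr u)"
  shows "hausdorff_measure u W = 0"
  unfolding hausdorff_measure_eq_0_iff
proof (intro allI impI)
  fix \<delta> :: real assume \<delta>: "\<delta> > 0"
  let ?t = "\<lambda>n. \<Sum>I\<in>F n. diameter (B I) powr u"
  have t0: "0 \<le> ?t n" for n by (simp add: sum_nonneg)
  have "?t \<longlonglongrightarrow> 0" by (rule summable_LIMSEQ_zero[OF sm])
  then have "eventually (\<lambda>n. ?t n < \<delta> powr u) sequentially"
    by (rule order_tendstoD) (use \<delta> in auto)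
  then obtain M where M: "\<And>n. n \<ge> M \<Longrightarrow> ?t n < \<delta> powr u"
    by (auto simp: eventually_sequentially)
  have diam: "diameter (B I) \<le> \<delta>" if "n \<ge> M" "I \<in> F n" for n I
  proof -
    have "diameter (B I) powr u \<le> ?t n"
      by (rule member_le_sum[OF that(2)]) (auto simp: fin)
    also have "\<dots> < \<delta> powr u" by (rule M[OF that(1)])
    finally have "diameter (B I) powr u < \<delta> powr u" .
    then show ?thesis
      using powr_mono2[of u \<delta> "diameter (B I)"] u \<delta> by force
  qed
  have bound: "hausdorff_premeasure u \<delta> W \<le> ennreal (\<Sum>n. ?t (n + N))" if N: "N \<ge> M" for N
  proof -
    have "W \<subseteq> (\<Union>n. \<Union>I\<in>F (n + N). B I)"
    proof
      fix x assume "x \<in> W"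
      then obtain n I where "n \<ge> N" "I \<in> F n" "x \<in> B I" using cover[of N] by blast
      then have "x \<in> (\<Union>I\<in>F ((n - N) + N). B I)" by auto
      then show "x \<in> (\<Union>n. \<Union>I\<in>F (n + N). B I)" by blast
    qed
    then have "hausdorff_premeasure u \<delta> W
        \<le> (\<Sum>n. hausdorff_premeasure u \<delta> (\<Union>I\<in>F (n + N). B I))"
      by (rule order_trans[OF hausdorff_premeasure_mono hausdorff_premeasure_UN_le])
    also have "\<dots> \<le> (\<Sum>n. ennreal (?t (n + N)))"
    proof (rule suminf_le)
      fix n
      have "hausdorff_premeasure u \<delta> (\<Union>I\<in>F (n + N). B I)
          \<le> (\<Sum>I\<in>F (n + N). hausdorff_premeasure u \<delta> (B I))"
        by (rule hausdorff_premeasure_finite_UN_le) (use fin \<delta> in auto)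
      also have "\<dots> \<le> (\<Sum>I\<in>F (n + N). ennreal (diameter (B I) powr u))"
      proof (rule sum_mono)
        fix I assume I: "I \<in> F (n + N)"
        have "hausdorff_premeasure u \<delta> (B I) \<le> ennreal (diam_pow u (B I))"
          by (rule hausdorff_premeasure_single) (use bdd[OF I] diam[of "n + N" I] I N \<delta> in auto)
        also have "\<dots> \<le> ennreal (diameter (B I) powr u)"
          using u by (auto simp: diam_pow_def)
        finally show "hausdorff_premeasure u \<delta> (B I) \<le> ennreal (diameter (B I) powr u)" .
      qed
      also have "\<dots> = ennreal (?t (n + N))" by (rule sum_ennreal) auto
      finally show "hausdorff_premeasure u \<delta> (\<Union>I\<in>F (n + N). B I) \<le> ennreal (?t (n + N))" .
    qed auto
    also have "\<dots> = ennreal (\<Sum>n. ?t (n + N))"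
      by (rule suminf_ennreal2) (use t0 summable_ignore_initial_segment[OF sm] in auto)
    finally show ?thesis .
  qed
  have "(\<lambda>N. ennreal (\<Sum>n. ?t (n + N))) \<longlonglongrightarrow> ennreal 0"
    by (intro tendsto_ennrealI suminf_exist_split2[OF sm])
  then have "hausdorff_premeasure u \<delta> W \<le> ennreal 0"
    by (rule LIMSEQ_le_const) (use bound in blast)
  then show "hausdorff_premeasure u \<delta> W = 0" by simp
qed

section \<open>Words and their compositions\<close>

lemma word_map_Nil [simp]: "word_map \<phi> [] = id"
  by (simp add: word_map_def)

lemma word_map_Cons [simp]: "word_map \<phi> (i # I) = \<phi> i \<circ> word_map \<phi> I"
  by (simp add: word_map_def)

lemma word_map_append: "word_map \<phi> (I @ J) = word_map \<phi> I \<circ> word_map \<phi> J"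
  by (induction I) (auto simp: comp_assoc)

lemma word_map_in:
  assumes "\<And>i x. i \<in> D \<Longrightarrow> x \<in> S \<Longrightarrow> \<phi> i x \<in> S" "set I \<subseteq> D" "x \<in> S"
  shows "word_map \<phi> I x \<in> S"
  using assms(2) by (induction I) (use assms(1,3) in auto)

lemma finite_words: "finite D \<Longrightarrow> finite (words D n)"
  unfolding words_def by (rule finite_lists_length_eq)

lemma words_0 [simp]: "words D 0 = {[]}"
  by (auto simp: words_def)

definition concat_sets :: "'i list set \<Rightarrow> 'i list set \<Rightarrow> 'i list set" where
  "concat_sets A B = (\<lambda>(I, J). I @ J) ` (A \<times> B)"

lemma concat_sets_words: "concat_sets (words D n) (words D m) = words D (n + m)"
proof
  show "words D (n + m) \<subseteq> concat_sets (words D n) (words D m)"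
  proof
    fix I assume I: "I \<in> words D (n + m)"
    then have "take n I \<in> words D n" "drop n I \<in> words D m"
      using set_take_subset[of n I] set_drop_subset[of n I] by (auto simp: words_def)
    then have "take n I @ drop n I \<in> concat_sets (words D n) (words D m)"
      unfolding concat_sets_def by (auto intro!: rev_image_eqI)
    then show "I \<in> concat_sets (words D n) (words D m)" by simp
  qed
qed (auto simp: concat_sets_def words_def)

lemma concat_sets_mono: "A \<subseteq> A' \<Longrightarrow> B \<subseteq> B' \<Longrightarrow> concat_sets A B \<subseteq> concat_sets A' B'"
  by (auto simp: concat_sets_def)

lemma concat_sets_subset_words:
  "A \<subseteq> words D n \<Longrightarrow> B \<subseteq> words D m \<Longrightarrow> concat_sets A B \<subseteq> words D (n + m)"
  using concat_sets_mono concat_sets_words by metis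

section \<open>Level sums and reduced words\<close>

text \<open>
  The thermodynamic part of the argument rests on four properties of the derivative norms
  \<open>g I x = |\<phi>\<^sub>I'(x)|\<close>: the chain rule, exponential upper and lower bounds in the length of the word, and bounded
  distortion.
\<close>

locale cocycle =
  fixes D :: "'i set" and \<phi> :: "'i \<Rightarrow> 'a \<Rightarrow> 'a" and X :: "'a set"
    and g :: "'i list \<Rightarrow> 'a \<Rightarrow> real" and \<kappa> r C :: real
  assumes finite_D: "finite D" and X_nonempty: "X \<noteq> {}"
    and invariant: "i \<in> D \<Longrightarrow> x \<in> X \<Longrightarrow> \<phi> i x \<in> X"
    and g_append: "set I \<subseteq> D \<Longrightarrow> set J \<subseteq> D \<Longrightarrow> x \<in> X \<Longrightarrow>
          g (I @ J) x = g I (word_map \<phi> J x) * g J x"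
    and g_lower: "set I \<subseteq> D \<Longrightarrow> x \<in> X \<Longrightarrow> \<kappa> ^ length I \<le> g I x"
    and g_upper: "set I \<subseteq> D \<Longrightarrow> x \<in> X \<Longrightarrow> g I x \<le> r ^ length I"
    and distortion: "set I \<subseteq> D \<Longrightarrow> x \<in> X \<Longrightarrow> y \<in> X \<Longrightarrow> g I x \<le> C * g I y"
    and \<kappa>_pos: "0 < \<kappa>" and r_less_1: "r < 1"
    and card_D: "2 \<le> card D"
begin

definition Z :: "real \<Rightarrow> 'i list set \<Rightarrow> 'a \<Rightarrow> real" where
  "Z s A x = (\<Sum>I\<in>A. g I x powr s)"

lemma word_map_X: "set I \<subseteq> D \<Longrightarrow> x \<in> X \<Longrightarrow> word_map \<phi> I x \<in> X"
  by (rule word_map_in[of D X]) (use invariant in auto)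

lemma g_pos: "set I \<subseteq> D \<Longrightarrow> x \<in> X \<Longrightarrow> 0 < g I x"
  using g_lower[of I x] \<kappa>_pos by (meson less_le_trans zero_less_power)

lemma g_Nil: "x \<in> X \<Longrightarrow> g [] x = 1"
  using g_lower[of "[]" x] g_upper[of "[]" x] by simp

lemma \<kappa>_le_r: "\<kappa> \<le> r" and \<kappa>_less_1: "\<kappa> < 1" and r_pos: "0 < r"
proof -
  obtain i where i: "i \<in> D" using card_D by fastforce
  obtain x where x: "x \<in> X" using X_nonempty by blast
  show 1: "\<kappa> \<le> r" using g_lower[of "[i]" x] g_upper[of "[i]" x] i x by simp
  then show "\<kappa> < 1" "0 < r" using r_less_1 \<kappa>_pos by auto
qed

lemma C_ge_1: "1 \<le> C"
proof -
  obtain x where x: "x \<in> X" using X_nonempty by blast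
  show ?thesis using distortion[of "[]" x x] x g_Nil[of x] by simp
qed

lemma Z_Nil: "x \<in> X \<Longrightarrow> Z s {[]} x = 1"
  by (simp add: Z_def g_Nil)

lemma Z_nonneg: "0 \<le> Z s A x"
  by (simp add: Z_def sum_nonneg)

text \<open>
  By the chain rule, appending the words of \<open>B\<close> on the right applies the transfer operator of \<open>B\<close> to
  the sum over \<open>A\<close>.
\<close>

lemma Z_concat:
  assumes A: "A \<subseteq> words D n" and B: "B \<subseteq> words D m" and x: "x \<in> X"
  shows "Z s (concat_sets A B) x = (\<Sum>J\<in>B. g J x powr s * Z s A (word_map \<phi> J x))"
proof -
  have inj: "inj_on (\<lambda>(I, J). I @ J) (A \<times> B)"
  proof (rule inj_onI, clarify)
    fix I J I' J' assume "I \<in> A" "I' \<in> A" "I @ J = I' @ J'"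
    moreover from this have "length I = length I'" using A by (auto simp: words_def)
    ultimately show "I = I' \<and> J = J'" by simp
  qed
  have "Z s (concat_sets A B) x = (\<Sum>(I, J)\<in>A \<times> B. g (I @ J) x powr s)"
    unfolding Z_def concat_sets_def by (subst sum.reindex[OF inj]) (simp add: case_prod_beta)
  also have "\<dots> = (\<Sum>(I, J)\<in>A \<times> B. g J x powr s * g I (word_map \<phi> J x) powr s)"
  proof (intro sum.cong refl, clarify)
    fix I J assume "I \<in> A" "J \<in> B"
    then have IJ: "set I \<subseteq> D" "set J \<subseteq> D" using A B by (auto simp: words_def)
    then show "g (I @ J) x powr s = g J x powr s * g I (word_map \<phi> J x) powr s"
      using g_pos[OF IJ(1) word_map_X[OF IJ(2) x]] g_pos[OF IJ(2) x] x
      by (simp add: g_append powr_mult)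
  qed
  also have "\<dots> = (\<Sum>J\<in>B. g J x powr s * Z s A (word_map \<phi> J x))"
    unfolding Z_def sum_distrib_left by (subst sum.swap) (simp add: sum.cartesian_product)
  finally show ?thesis .
qed

lemma Z_concat_le:
  assumes "A \<subseteq> words D n" "B \<subseteq> words D m" "x \<in> X" "\<And>y. y \<in> X \<Longrightarrow> Z s A y \<le> a"
  shows "Z s (concat_sets A B) x \<le> a * Z s B x"
proof -
  have "Z s (concat_sets A B) x \<le> (\<Sum>J\<in>B. g J x powr s * a)"
    unfolding Z_concat[OF assms(1-3)]
    by (intro sum_mono mult_left_mono assms(4) word_map_X)
       (use assms(2,3) in \<open>auto simp: words_def\<close>)
  also have "\<dots> = a * Z s B x" by (simp add: Z_def sum_distrib_left mult.commute)
  finally show ?thesis .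
qed

lemma Z_concat_ge:
  assumes "A \<subseteq> words D n" "B \<subseteq> words D m" "x \<in> X" "\<And>y. y \<in> X \<Longrightarrow> a \<le> Z s A y"
  shows "a * Z s B x \<le> Z s (concat_sets A B) x"
proof -
  have "a * Z s B x = (\<Sum>J\<in>B. g J x powr s * a)" 
    by (simp add: Z_def sum_distrib_left mult.commute)
  also have "\<dots> \<le> Z s (concat_sets A B) x"
    unfolding Z_concat[OF assms(1-3)]
    by (intro sum_mono mult_left_mono assms(4) word_map_X)
       (use assms(2,3) in \<open>auto simp: words_def\<close>)
  finally show ?thesis .
qed

lemma Z_words_mult_le:
  assumes "\<And>y. y \<in> X \<Longrightarrow> Z s (words D n) y \<le> a" "x \<in> X" "0 \<le> a"
  shows "Z s (words D (n * j)) x \<le> a ^ j"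
  using assms(2)
proof (induction j arbitrary: x)
  case (Suc j)
  have "Z s (words D (n + n * j)) x \<le> a * Z s (words D (n * j)) x"
    unfolding concat_sets_words[symmetric]
    by (rule Z_concat_le) (use assms(1) Suc in \<open>auto simp: concat_sets_words\<close>)
  also have "\<dots> \<le> a * a ^ j" by (rule mult_left_mono) (use Suc assms(3) in auto)
  finally show ?case by simp
qed (simp add: Z_Nil)

lemma Z_words_mult_ge:
  assumes "\<And>y. y \<in> X \<Longrightarrow> a \<le> Z s (words D n) y" "x \<in> X" "0 \<le> a"
  shows "a ^ j \<le> Z s (words D (n * j)) x"
  using assms(2)
proof (induction j arbitrary: x)
  case (Suc j)
  have "a * a ^ j \<le> a * Z s (words D (n * j)) x"
    by (rule mult_left_mono) (use Suc assms(3) in auto)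
  also have "\<dots> \<le> Z s (words D (n + n * j)) x"
    unfolding concat_sets_words[symmetric]
    by (rule Z_concat_ge) (use assms(1) Suc in \<open>auto simp: concat_sets_words\<close>)
  finally show ?case by simp
qed (simp add: Z_Nil)

lemma Z_distortion:
  assumes "A \<subseteq> words D n" "x \<in> X" "y \<in> X" "0 \<le> s"
  shows "Z s A x \<le> C powr s * Z s A y"
proof -
  have "g I x powr s \<le> C powr s * g I y powr s" if "I \<in> A" for I
  proof -
    have I: "set I \<subseteq> D" using that assms(1) by (auto simp: words_def)
    have "g I x powr s \<le> (C * g I y) powr s"
      by (rule powr_mono2) (use distortion[OF I] g_pos[OF I assms(2)] assms in auto)
    also have "\<dots> = C powr s * g I y powr s"
      using C_ge_1 g_pos[OF I assms(3)] by (simp add: powr_mult)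
    finally show ?thesis .
  qed
  then show ?thesis unfolding Z_def sum_distrib_left by (intro sum_mono)
qed

lemma Z_exponent_upper:
  assumes "A \<subseteq> words D n" "x \<in> X" "s \<le> t"
  shows "Z t A x \<le> (r ^ n) powr (t - s) * Z s A x"
proof -
  have "g I x powr t \<le> (r ^ n) powr (t - s) * g I x powr s" if "I \<in> A" for I
  proof -
    have I: "set I \<subseteq> D" "length I = n" using that assms(1) by (auto simp: words_def)
    have "g I x powr t = g I x powr (t - s) * g I x powr s"
      by (simp flip: powr_add)
    also have "\<dots> \<le> (r ^ n) powr (t - s) * g I x powr s"
      by (intro mult_right_mono powr_mono2)
         (use g_upper[OF I(1)] g_pos[OF I(1) assms(2)] I(2) assms in auto)
    finally show ?thesis .
  qed
  then show ?thesis unfolding Z_def sum_distrib_left by (intro sum_mono)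
qed

lemma Z_exponent_lower:
  assumes "A \<subseteq> words D n" "x \<in> X" "s \<le> t"
  shows "(\<kappa> ^ n) powr (t - s) * Z s A x \<le> Z t A x"
proof -
  have "(\<kappa> ^ n) powr (t - s) * g I x powr s \<le> g I x powr t" if "I \<in> A" for I
  proof -
    have I: "set I \<subseteq> D" "length I = n" using that assms(1) by (auto simp: words_def)
    have "(\<kappa> ^ n) powr (t - s) * g I x powr s \<le> g I x powr (t - s) * g I x powr s"
      by (intro mult_right_mono powr_mono2)
         (use g_lower[OF I(1)] \<kappa>_pos I(2) assms in auto)
    also have "\<dots> = g I x powr t"
      by (simp flip: powr_add)
    finally show ?thesis .
  qed
  then show ?thesis unfolding Z_def sum_distrib_left by (intro sum_mono)
qed

lemma Z_0: "x \<in> X \<Longrightarrow> Z 0 (words D n) x = real (card D ^ n)"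
proof -
  assume x: "x \<in> X"
  have "Z 0 (words D n) x = (\<Sum>I\<in>words D n. 1)"
    unfolding Z_def by (rule sum.cong) (use g_pos[OF _ x] in \<open>force simp: words_def\<close>)+
  then show ?thesis using card_lists_length_eq[OF finite_D] by (simp add: words_def)
qed

text \<open>
  Let \<open>B\<close> be the set of nonnegative exponents at which some level sum is uniformly below \<open>1\<close>.  It is an
  upper set, and by continuity in the exponent it does not contain its infimum \<open>\<sigma>\<close>; distortion turns
  this into a lower bound for all level sums at \<open>\<sigma>\<close>.  If a level sum at \<open>\<sigma>\<close> were so large that it exceeds \<open>1\<close> everywhere, it would
  still do so slightly above \<open>\<sigma>\<close>; submultiplicativity and supermultiplicativity then contradict each
  other on a common multiple of two levels.  With at least two symbols \<open>\<sigma> = 0\<close> is impossible, since the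
  level sums at \<open>0\<close> count words.
\<close>

lemma critical_exponent_exists:
  "\<exists>s>0. \<exists>K\<ge>1. \<forall>n. \<forall>x\<in>X. 1 / K \<le> Z s (words D n) x \<and> Z s (words D n) x \<le> K"
proof -
  define B where "B = {s. 0 \<le> s \<and> (\<exists>n. \<exists>a<1. \<forall>x\<in>X. Z s (words D n) x \<le> a)}"
  define \<sigma> where "\<sigma> = Inf B"
  obtain x0 where x0: "x0 \<in> X" using X_nonempty by blast
  have B_nonneg: "0 \<le> s" if "s \<in> B" for s using that by (simp add: B_def)
  have bdd: "bdd_below B" using B_nonneg by (intro bdd_belowI[of _ 0])
  have B_up: "t \<in> B" if "s \<in> B" "s \<le> t" for s t
  proof -
    obtain n a where a: "a < 1" "\<forall>x\<in>X. Z s (words D n) x \<le> a" and s: "0 \<le> s"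
      using \<open>s \<in> B\<close> by (auto simp: B_def)
    have "Z t (words D n) x \<le> a" if x: "x \<in> X" for x
    proof -
      have "Z t (words D n) x \<le> (r ^ n) powr (t - s) * Z s (words D n) x"
        by (rule Z_exponent_upper) (use x \<open>s \<le> t\<close> in auto)
      also have "\<dots> \<le> 1 * Z s (words D n) x"
        by (intro mult_right_mono Z_nonneg powr_le1)
           (use r_pos r_less_1 \<open>s \<le> t\<close> in \<open>auto intro: power_le_one\<close>)
      finally show ?thesis using a(2) x by force
    qed
    then show ?thesis using a(1) s \<open>s \<le> t\<close> by (auto simp: B_def)
  qed
  have "B \<noteq> {}"
  proof -
    have "(\<lambda>t. r powr t * real (card D)) \<longlonglongrightarrow> 0 * real (card D)" if "True"
      by (intro tendsto_mult tendsto_const)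
         (use r_pos r_less_1 in \<open>auto intro!: LIMSEQ_realpow_zero simp: powr_realpow\<close>)
    then have "eventually (\<lambda>t::nat. r powr t * real (card D) < 1) sequentially"
      by (auto dest!: order_tendstoD(2)[of _ _ _ 1])
    then obtain t :: nat where t: "r powr t * real (card D) < 1"
      by (auto simp: eventually_sequentially)
    have "Z t (words D 1) x \<le> r powr t * real (card D)" if "x \<in> X" for x
      using Z_exponent_upper[of "words D 1" 1 x 0 t] Z_0[OF that, of 1] that by simp
    then have "real t \<in> B" using t by (force simp: B_def)
    then show ?thesis by blast
  qed
  have \<sigma>_notin: "\<sigma> \<notin> B"
  proof
    assume \<sigma>: "\<sigma> \<in> B"
    then obtain n a where a: "a < 1" "\<And>x. x \<in> X \<Longrightarrow> Z \<sigma> (words D n) x \<le> a"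
      by (auto simp: B_def)
    have "\<sigma> \<noteq> 0"
    proof
      assume "\<sigma> = 0"
      then have "real (card D ^ n) < 1" using a(1) a(2)[OF x0] Z_0[OF x0] by simp
      moreover have "1 \<le> card D ^ n" using card_D by simp
      ultimately show False by (metis not_le of_nat_1 of_nat_le_iff)
    qed
    then have \<sigma>_pos: "0 < \<sigma>" using B_nonneg[OF \<sigma>] by simp
    have "((\<lambda>e. (\<kappa> ^ n) powr e) \<longlongrightarrow> (\<kappa> ^ n) powr 0) (at_right 0)"
      using \<kappa>_pos by (intro tendsto_intros) auto
    then have "eventually (\<lambda>e. (\<kappa> ^ n) powr e > a) (at_right 0)"
      using a(1) \<kappa>_pos by (intro order_tendstoD) auto
    moreover have "eventually (\<lambda>e. e \<in> {0<..<\<sigma>}) (at_right 0)"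
      using eventually_at_right_real[OF \<sigma>_pos] .
    ultimately have "\<exists>e. e \<in> {0<..<\<sigma>} \<and> (\<kappa> ^ n) powr e > a"
      by (intro eventually_happens'[OF trivial_limit_at_right_real] eventually_conj)
    then obtain e where e: "0 < e" "e < \<sigma>" "(\<kappa> ^ n) powr e > a"
      by auto
    have "Z (\<sigma> - e) (words D n) x \<le> a / (\<kappa> ^ n) powr e" if x: "x \<in> X" for x
    proof -
      have "(\<kappa> ^ n) powr e * Z (\<sigma> - e) (words D n) x \<le> a"
        using Z_exponent_lower[of "words D n" n x "\<sigma> - e" \<sigma>] a(2)[OF x] x e by simp
      then show ?thesis using \<kappa>_pos by (simp add: field_simps)
    qed
    moreover have "a / (\<kappa> ^ n) powr e < 1" using e(3) \<kappa>_pos by (simp add: field_simps)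
    ultimately have "\<sigma> - e \<in> B" using e by (auto simp: B_def)
    then have "\<sigma> \<le> \<sigma> - e" unfolding \<sigma>_def by (rule cInf_lower[OF _ bdd])
    then show False using e by simp
  qed
  have \<sigma>_nonneg: "0 \<le> \<sigma>" unfolding \<sigma>_def by (rule cInf_greatest[OF \<open>B \<noteq> {}\<close> B_nonneg])
  define K where "K = C powr \<sigma>"
  have K: "1 \<le> K" unfolding K_def using C_ge_1 \<sigma>_nonneg by (rule ge_one_powr_ge_zero)
  have dist: "Z \<sigma> (words D n) x \<le> K * Z \<sigma> (words D n) y" if "x \<in> X" "y \<in> X" for n x y
    unfolding K_def by (rule Z_distortion) (use that \<sigma>_nonneg in auto)
  have lower: "1 / K \<le> Z \<sigma> (words D n) x" if x: "x \<in> X" for n x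
  proof (rule ccontr)
    assume "\<not> 1 / K \<le> Z \<sigma> (words D n) x"
    then have "K * Z \<sigma> (words D n) x < 1" using K by (simp add: field_simps)
    then have "\<sigma> \<in> B" using dist[OF _ x] \<sigma>_nonneg by (auto simp: B_def)
    then show False using \<sigma>_notin by simp
  qed
  have upper: "Z \<sigma> (words D m) x \<le> K" if x: "x \<in> X" for m x
  proof (rule ccontr)
    assume big: "\<not> Z \<sigma> (words D m) x \<le> K"
    define b where "b = Z \<sigma> (words D m) x / K"
    have b: "1 < b" using big K by (simp add: b_def field_simps)
    have b_le: "b \<le> Z \<sigma> (words D m) y" if "y \<in> X" for y
      using dist[OF x that, of m] K by (simp add: b_def field_simps)
    have "m \<noteq> 0" using big K Z_Nil[OF x, of \<sigma>] by (intro notI) simp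
    have "((\<lambda>e. (\<kappa> ^ m) powr e * b) \<longlongrightarrow> (\<kappa> ^ m) powr 0 * b) (at_right 0)"
      using \<kappa>_pos by (intro tendsto_intros) auto
    then have "eventually (\<lambda>e. (\<kappa> ^ m) powr e * b > 1) (at_right 0)"
      using b \<kappa>_pos by (intro order_tendstoD) auto
    moreover have "eventually (\<lambda>e. e \<in> {0<..<1}) (at_right (0::real))"
      by (rule eventually_at_right_real) simp
    ultimately have "\<exists>e. e \<in> {0<..<1::real} \<and> (\<kappa> ^ m) powr e * b > 1"
      by (intro eventually_happens'[OF trivial_limit_at_right_real] eventually_conj)
    then obtain e where e: "0 < e" "(\<kappa> ^ m) powr e * b > 1"
      by auto
    have "\<exists>s\<in>B. s < \<sigma> + e"
      unfolding \<sigma>_def using cInf_lessD[OF \<open>B \<noteq> {}\<close>, of "Inf B + e"] e by auto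
    then have "\<sigma> + e \<in> B" using B_up by force
    then obtain n a where a: "a < 1" "\<And>y. y \<in> X \<Longrightarrow> Z (\<sigma> + e) (words D n) y \<le> a"
      by (auto simp: B_def)
    have a0: "0 \<le> a" using a(2)[OF x] Z_nonneg[of "\<sigma> + e" "words D n" x] by linarith
    have ge1: "1 \<le> Z (\<sigma> + e) (words D m) y" if y: "y \<in> X" for y
    proof -
      have "1 \<le> (\<kappa> ^ m) powr e * b" using e by simp
      also have "\<dots> \<le> (\<kappa> ^ m) powr e * Z \<sigma> (words D m) y"
        by (rule mult_left_mono) (use b_le[OF y] in auto)
      also have "\<dots> \<le> Z (\<sigma> + e) (words D m) y"
        using Z_exponent_lower[of "words D m" m y \<sigma> "\<sigma> + e"] y e by simp
      finally show ?thesis .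
    qed
    have "1 ^ n \<le> Z (\<sigma> + e) (words D (m * n)) x"
      by (rule Z_words_mult_ge) (use ge1 x in auto)
    also have "\<dots> = Z (\<sigma> + e) (words D (n * m)) x" by (simp add: mult.commute)
    also have "\<dots> \<le> a ^ m" by (rule Z_words_mult_le) (use a a0 x in auto)
    also have "\<dots> < 1" using \<open>m \<noteq> 0\<close> a a0 by (simp add: power_less_one_iff)
    finally show False by simp
  qed
  have "\<sigma> \<noteq> 0"
  proof
    assume "\<sigma> = 0"
    then have "2 ^ n \<le> K" for n :: nat
    proof -
      have "(2::real) ^ n \<le> real (card D) ^ n"
        using card_D by (intro power_mono) auto
      also have "\<dots> \<le> K" using upper[OF x0, of n] Z_0[OF x0, of n] \<open>\<sigma> = 0\<close> by simp
      finally show ?thesis .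
    qed
    then show False using real_arch_pow[of 2 K] by (meson not_le one_less_numeral_iff semiring_norm(76))
  qed
  then show ?thesis using lower upper K \<sigma>_nonneg by (intro exI[of _ \<sigma>] conjI exI[of _ K]) auto
qed

lemma zero_pressure_of_bounds:
  assumes K: "1 \<le> K"
    and bounds: "\<And>n x. x \<in> X \<Longrightarrow> 1 / K \<le> Z s (words D n) x \<and> Z s (words D n) x \<le> K"
  shows "(\<lambda>n. 1 / real n * ln (INF x\<in>X. Z s (words D n) x)) \<longlonglongrightarrow> 0"
    and "(\<lambda>n. 1 / real n * ln (SUP x\<in>X. Z s (words D n) x)) \<longlonglongrightarrow> 0"
proof -
  have lim: "(\<lambda>n. 1 / real n * ln (f n)) \<longlonglongrightarrow> 0"
    if f: "\<And>n. 1 / K \<le> f n \<and> f n \<le> K" for f :: "nat \<Rightarrow> real"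
  proof (rule Lim_null_comparison)
    have "\<bar>ln (f n)\<bar> \<le> ln K" for n
    proof -
      have "0 < f n" using f[of n] K by (meson less_le_trans zero_less_divide_1_iff zero_less_one)
      then have "ln (f n) \<le> ln K" "ln (1 / K) \<le> ln (f n)" using f[of n] K by simp_all
      then show ?thesis using K by (simp add: ln_div)
    qed
    then have "norm (1 / real n * ln (f n)) \<le> ln K * inverse (real n)" for n
      using mult_right_mono[of "\<bar>ln (f n)\<bar>" "ln K" "inverse (real n)"]
      by (simp add: abs_mult divide_inverse mult.commute)
    then show "eventually (\<lambda>n. norm (1 / real n * ln (f n)) \<le> ln K * inverse (real n)) sequentially"
      by simp
    show "(\<lambda>n. ln K * inverse (real n)) \<longlonglongrightarrow> 0"
      using tendsto_mult[OF tendsto_const lim_inverse_n[where 'a = real]] by simp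
  qed
  have bdd: "bdd_below (Z s (words D n) ` X)" "bdd_above (Z s (words D n) ` X)" for n
    using bounds by (auto intro!: bdd_belowI2[of _ "1 / K"] bdd_aboveI2[of _ _ K])
  obtain x0 where x0: "x0 \<in> X" using X_nonempty by blast
  show "(\<lambda>n. 1 / real n * ln (INF x\<in>X. Z s (words D n) x)) \<longlonglongrightarrow> 0"
    using X_nonempty bounds x0
    by (intro lim conjI cINF_greatest cINF_lower2[OF bdd(1) x0]) auto
  show "(\<lambda>n. 1 / real n * ln (SUP x\<in>X. Z s (words D n) x)) \<longlonglongrightarrow> 0"
    using X_nonempty bounds x0
    by (intro lim conjI cSUP_least cSUP_upper2[OF bdd(2) x0]) auto
qed

text \<open>
  Raising the exponent by \<open>e > 0\<close> multiplies each level sum by at most \<open>r\<^bsup>n e\<^esup>\<close>, hence lowers the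
  pressure by at least \<open>e |ln r|\<close>; the pressure is strictly decreasing.
\<close>

lemma zero_pressure_unique:
  assumes K: "1 \<le> K"
    and bounds: "\<And>n x. x \<in> X \<Longrightarrow> 1 / K \<le> Z s (words D n) x \<and> Z s (words D n) x \<le> K"
    and inf: "(\<lambda>n. 1 / real n * ln (INF x\<in>X. Z t (words D n) x)) \<longlonglongrightarrow> 0"
    and sup: "(\<lambda>n. 1 / real n * ln (SUP x\<in>X. Z t (words D n) x)) \<longlonglongrightarrow> 0"
  shows "t = s"
proof -
  obtain x0 where x0: "x0 \<in> X" using X_nonempty by blast
  have lnr: "ln r < 0" using r_pos r_less_1 by simp
  have inv: "(\<lambda>n. ln K * inverse (real n)) \<longlonglongrightarrow> 0"
    using tendsto_mult[OF tendsto_const lim_inverse_n[where 'a = real]] by simp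
  consider "s < t" | "t < s" | "t = s" by linarith
  then show ?thesis
  proof cases
    case 1
    have "1 / real n * ln (SUP x\<in>X. Z t (words D n) x) \<le> ln K * inverse (real n) + (t - s) * ln r"
      if n: "n > 0" for n
    proof -
      have le: "Z t (words D n) x \<le> (r ^ n) powr (t - s) * K" if x: "x \<in> X" for x
      proof -
        have "Z t (words D n) x \<le> (r ^ n) powr (t - s) * Z s (words D n) x"
          by (rule Z_exponent_upper) (use x 1 in auto)
        also have "\<dots> \<le> (r ^ n) powr (t - s) * K"
          by (rule mult_left_mono) (use bounds[OF x] in auto)
        finally show ?thesis .
      qed
      have sup_le: "(SUP x\<in>X. Z t (words D n) x) \<le> (r ^ n) powr (t - s) * K"
        by (rule cSUP_least[OF X_nonempty le])
      have "0 < (\<kappa> ^ n) powr (t - s) * (1 / K)" using \<kappa>_pos K by simp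
      also have "\<dots> \<le> (\<kappa> ^ n) powr (t - s) * Z s (words D n) x0"
        by (rule mult_left_mono) (use bounds[OF x0] in auto)
      also have "\<dots> \<le> Z t (words D n) x0"
        by (rule Z_exponent_lower) (use x0 1 in auto)
      also have "\<dots> \<le> (SUP x\<in>X. Z t (words D n) x)"
        by (rule cSUP_upper[OF x0]) (use le in \<open>auto intro!: bdd_aboveI2\<close>)
      finally have "ln (SUP x\<in>X. Z t (words D n) x) \<le> ln ((r ^ n) powr (t - s) * K)"
        using sup_le by simp
      also have "\<dots> = (t - s) * real n * ln r + ln K"
        using r_pos K by (simp add: ln_mult ln_powr ln_realpow)
      finally show ?thesis using n by (simp add: field_simps)
    qed
    then have "eventually (\<lambda>n. 1 / real n * ln (SUP x\<in>X. Z t (words D n) x)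
        \<le> ln K * inverse (real n) + (t - s) * ln r) sequentially"
      by (auto intro: eventually_sequentiallyI[of 1])
    moreover have "(\<lambda>n. ln K * inverse (real n) + (t - s) * ln r) \<longlonglongrightarrow> 0 + (t - s) * ln r"
      by (intro tendsto_add inv tendsto_const)
    ultimately have "0 \<le> 0 + (t - s) * ln r"
      by (intro tendsto_le[OF _ _ sup]) auto
    then show ?thesis using lnr 1 by (simp add: zero_le_mult_iff)
  next
    case 2
    have "- ln K * inverse (real n) + (t - s) * ln r \<le> 1 / real n * ln (INF x\<in>X. Z t (words D n) x)"
      if n: "n > 0" for n
    proof -
      have ge: "(r ^ n) powr (t - s) * (1 / K) \<le> Z t (words D n) x" if x: "x \<in> X" for x
      proof -
        have "(r ^ n) powr (t - s) * (1 / K) \<le> (r ^ n) powr (t - s) * Z s (words D n) x"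
          by (rule mult_left_mono) (use bounds[OF x] in auto)
        also have "\<dots> \<le> (r ^ n) powr (t - s) * ((r ^ n) powr (s - t) * Z t (words D n) x)"
          by (intro mult_left_mono Z_exponent_upper) (use x 2 in auto)
        also have "\<dots> = Z t (words D n) x"
          using r_pos by (simp flip: mult.assoc powr_add)
        finally show ?thesis .
      qed
      have inf_ge: "(r ^ n) powr (t - s) * (1 / K) \<le> (INF x\<in>X. Z t (words D n) x)"
        by (rule cINF_greatest[OF X_nonempty ge])
      have pos: "0 < (r ^ n) powr (t - s) * (1 / K)" using r_pos K by simp
      have "(t - s) * real n * ln r - ln K = ln ((r ^ n) powr (t - s) * (1 / K))"
        using r_pos K by (simp add: ln_div ln_powr ln_realpow)
      also have "\<dots> \<le> ln (INF x\<in>X. Z t (words D n) x)"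
        using inf_ge pos by simp
      finally have "((t - s) * real n * ln r - ln K) / real n
          \<le> ln (INF x\<in>X. Z t (words D n) x) / real n"
        by (rule divide_right_mono) simp
      moreover have "- ln K * inverse (real n) + (t - s) * ln r
          = ((t - s) * real n * ln r - ln K) / real n"
        using n by (simp add: field_simps)
      ultimately show ?thesis by simp
    qed
    then have "eventually (\<lambda>n. - ln K * inverse (real n) + (t - s) * ln r
        \<le> 1 / real n * ln (INF x\<in>X. Z t (words D n) x)) sequentially"
      by (auto intro: eventually_sequentiallyI[of 1])
    moreover have "(\<lambda>n. - ln K * inverse (real n) + (t - s) * ln r) \<longlonglongrightarrow> 0 + (t - s) * ln r"
      using tendsto_minus[OF inv] by (intro tendsto_add tendsto_const) simp
    ultimately have "0 + (t - s) * ln r \<le> 0"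
      by (intro tendsto_le[OF _ inf]) auto
    then show ?thesis using lnr 2 by (simp add: mult_le_0_iff)
  qed
qed

text \<open>
  Concatenations of \<open>q\<close> blocks of length \<open>k\<close>, none of which is \<open>J\<close>; the word \<open>J\<close> may
  still occur across block boundaries.
\<close>

primrec reduced :: "nat \<Rightarrow> 'i list \<Rightarrow> nat \<Rightarrow> 'i list set" where
  "reduced k J 0 = {[]}"
| "reduced k J (Suc q) = concat_sets (reduced k J q) (words D k - {J})"

text \<open>
  Level \<open>n\<close> is reached by \<open>n div k\<close> blocks and an unrestricted remainder shorter than a block.
\<close>

definition representatives :: "nat \<Rightarrow> 'i list \<Rightarrow> nat \<Rightarrow> 'i list set" where
  "representatives k J n = concat_sets (reduced k J (n div k)) (words D (n mod k))"

lemma reduced_subset: "reduced k J q \<subseteq> words D (q * k)"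
proof (induction q)
  case (Suc q)
  have "concat_sets (reduced k J q) (words D k - {J}) \<subseteq> words D (q * k + k)"
    by (rule concat_sets_subset_words) (use Suc in auto)
  then show ?case by (simp add: add.commute)
qed simp

lemma representatives_subset: "representatives k J n \<subseteq> words D n"
  using concat_sets_subset_words[OF reduced_subset[of k J "n div k"] order_refl[of "words D (n mod k)"]]
  by (simp add: representatives_def)

text \<open>
  Let \<open>L\<close> be the transfer operator of all words of length \<open>k\<close> and \<open>L\<^sub>A\<close> the operator with the word \<open>J\<close>
  left out.  The sum \<open>h\<close> of the first \<open>N\<close> iterates \<open>L\<^sup>n 1\<close> telescopes: \<open>L h\<close> exceeds \<open>h\<close> by at most a
  constant, while \<open>h\<close> itself is of size \<open>N\<close>, so \<open>h\<close> is almost superharmonic.  The summand for \<open>J\<close> takes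
  away at least a proportion \<open>\<delta>\<close> of \<open>h\<close> that does not depend on \<open>N\<close>.  For \<open>N\<close> large this
  gives \<open>L\<^sub>A h \<le> \<gamma> h\<close> with \<open>\<gamma> < 1\<close>, and iterating gives the decay.
\<close>

lemma reduced_decay:
  assumes s: "0 \<le> s" and K: "1 \<le> K"
    and bounds: "\<And>n x. x \<in> X \<Longrightarrow> 1 / K \<le> Z s (words D n) x \<and> Z s (words D n) x \<le> K"
    and J: "J \<in> words D k"
  shows "\<exists>\<gamma>\<in>{0<..<1}. \<forall>q. \<forall>x\<in>X. Z s (reduced k J q) x \<le> K ^ 2 * \<gamma> ^ q"
proof -
  define \<delta> where "\<delta> = (\<kappa> ^ k) powr s / K ^ 2"
  define \<gamma> where "\<gamma> = 1 - \<delta> / 2"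
  have "(\<kappa> ^ k) powr s \<le> 1"
    by (intro powr_le1) (use \<kappa>_pos \<kappa>_less_1 s in \<open>auto intro: power_le_one\<close>)
  moreover have "1 \<le> K ^ 2" using K by simp
  moreover have "0 < (\<kappa> ^ k) powr s" using \<kappa>_pos by simp
  ultimately have \<delta>: "0 < \<delta>" "\<delta> \<le> 1"
    by (auto simp: \<delta>_def divide_le_eq intro!: divide_pos_pos)
  then have \<gamma>: "0 < \<gamma>" "\<gamma> < 1" by (auto simp: \<gamma>_def)
  obtain N :: nat where N: "2 * K ^ 2 / \<delta> < real N" using reals_Archimedean2 by blast
  have "0 < 2 * K ^ 2 / \<delta>" using K \<delta> by simp
  then have N_pos: "0 < real N" using N by linarith
  define h where "h = (\<lambda>x. \<Sum>n<N. Z s (words D (n * k)) x)"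
  have h_ge: "real N / K \<le> h x" if "x \<in> X" for x
  proof -
    have "real N / K = (\<Sum>n<N. 1 / K)" by simp
    also have "\<dots> \<le> h x" unfolding h_def by (intro sum_mono) (use bounds that in auto)
    finally show ?thesis .
  qed
  have h_le: "h x \<le> real N * K" if "x \<in> X" for x
  proof -
    have "h x \<le> (\<Sum>n<N. K)" unfolding h_def by (intro sum_mono) (use bounds that in auto)
    then show ?thesis by simp
  qed
  have step: "(\<Sum>L\<in>words D k - {J}. g L x powr s * h (word_map \<phi> L x)) \<le> \<gamma> * h x"
    if x: "x \<in> X" for x
  proof -
    have J_D: "set J \<subseteq> D" "length J = k" using J by (auto simp: words_def)
    have "(\<Sum>L\<in>words D k. g L x powr s * h (word_map \<phi> L x))
        = (\<Sum>n<N. \<Sum>L\<in>words D k. g L x powr s * Z s (words D (n * k)) (word_map \<phi> L x))"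
      unfolding h_def sum_distrib_left by (rule sum.swap)
    also have "\<dots> = (\<Sum>n<N. Z s (words D (Suc n * k)) x)"
    proof (rule sum.cong[OF refl])
      fix n
      show "(\<Sum>L\<in>words D k. g L x powr s * Z s (words D (n * k)) (word_map \<phi> L x))
          = Z s (words D (Suc n * k)) x"
        using Z_concat[OF order_refl order_refl x, of s "n * k" k]
        by (simp add: concat_sets_words add.commute)
    qed
    also have "\<dots> = h x + Z s (words D (N * k)) x - Z s (words D (0 * k)) x"
      unfolding h_def using sum_lessThan_telescope[of "\<lambda>n. Z s (words D (n * k)) x" N]
      by (simp add: sum_subtractf)
    also have "\<dots> \<le> h x + K"
      using bounds[OF x, of "N * k"] by (simp add: Z_Nil x)
    finally have full: "(\<Sum>L\<in>words D k. g L x powr s * h (word_map \<phi> L x)) \<le> h x + K" .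
    have "\<delta> * h x \<le> \<delta> * (real N * K)"
      by (rule mult_left_mono) (use h_le[OF x] \<delta> in auto)
    also have "\<dots> = (\<kappa> ^ k) powr s * (real N / K)"
      using K by (simp add: \<delta>_def power2_eq_square)
    also have "\<dots> \<le> g J x powr s * h (word_map \<phi> J x)"
      by (intro mult_mono powr_mono2)
         (use s \<kappa>_pos g_lower[OF J_D(1) x] J_D h_ge[OF word_map_X[OF J_D(1) x]] K in auto)
    finally have removed: "\<delta> * h x \<le> g J x powr s * h (word_map \<phi> J x)" .
    have "K \<le> \<delta> / 2 * (real N / K)"
      using N \<delta> K by (simp add: field_simps power2_eq_square)
    also have "\<dots> \<le> \<delta> / 2 * h x"
      by (rule mult_left_mono) (use h_ge[OF x] \<delta> in auto)
    finally have K_le: "K \<le> \<delta> / 2 * h x" .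
    have "(\<Sum>L\<in>words D k - {J}. g L x powr s * h (word_map \<phi> L x))
        = (\<Sum>L\<in>words D k. g L x powr s * h (word_map \<phi> L x)) - g J x powr s * h (word_map \<phi> J x)"
      by (subst sum_diff1) (use J finite_words[OF finite_D] in auto)
    also have "\<dots> \<le> \<gamma> * h x" using full removed K_le by (simp add: \<gamma>_def algebra_simps)
    finally show ?thesis .
  qed
  have weighted: "Z s (reduced k J q) x \<le> K / real N * \<gamma> ^ q * h x" if "x \<in> X" for q x
    using that
  proof (induction q arbitrary: x)
    case 0
    then show ?case using h_ge[OF 0] K N_pos by (simp add: Z_Nil field_simps)
  next
    case (Suc q)
    have "Z s (reduced k J (Suc q)) x
        = (\<Sum>L\<in>words D k - {J}. g L x powr s * Z s (reduced k J q) (word_map \<phi> L x))"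
      unfolding reduced.simps by (rule Z_concat[OF reduced_subset _ Suc.prems]) auto
    also have "\<dots> \<le> (\<Sum>L\<in>words D k - {J}. g L x powr s * (K / real N * \<gamma> ^ q * h (word_map \<phi> L x)))"
      by (intro sum_mono mult_left_mono Suc.IH word_map_X Suc.prems) (auto simp: words_def)
    also have "\<dots> = K / real N * \<gamma> ^ q * (\<Sum>L\<in>words D k - {J}. g L x powr s * h (word_map \<phi> L x))"
      unfolding sum_distrib_left by (rule sum.cong) (auto simp: algebra_simps)
    also have "\<dots> \<le> K / real N * \<gamma> ^ q * (\<gamma> * h x)"
      by (intro mult_left_mono step Suc.prems) (use K \<gamma> in auto)
    finally show ?case by (simp add: mult_ac)
  qed
  have "Z s (reduced k J q) x \<le> K ^ 2 * \<gamma> ^ q" if x: "x \<in> X" for q x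
  proof -
    have "Z s (reduced k J q) x \<le> K / real N * \<gamma> ^ q * h x" by (rule weighted[OF x])
    also have "\<dots> \<le> K / real N * \<gamma> ^ q * (real N * K)"
      by (rule mult_left_mono) (use h_le[OF x] K \<gamma> in auto)
    finally show ?thesis using N_pos by (simp add: power2_eq_square mult_ac)
  qed
  then show ?thesis using \<gamma> by (intro bexI[of _ \<gamma>]) auto
qed

text \<open>
  Lowering the exponent by \<open>e\<close> costs a factor of at most \<open>\<kappa>\<^bsup>-n e\<^esup>\<close> at level \<open>n\<close>, and for small \<open>e\<close> this
  does not destroy the decay \<open>\<gamma>\<^bsup>n/k\<^esup>\<close>.
\<close>

lemma representatives_summable:
  assumes s: "0 < s" and K: "1 \<le> K"
    and bounds: "\<And>n x. x \<in> X \<Longrightarrow> 1 / K \<le> Z s (words D n) x \<and> Z s (words D n) x \<le> K"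
    and J: "J \<in> words D k" and k: "1 \<le> k" and x: "x \<in> X"
  shows "\<exists>e\<in>{0<..<s}. \<forall>t\<in>{s - e..s}. summable (\<lambda>n. Z t (representatives k J n) x)"
proof -
  obtain \<gamma> where \<gamma>: "0 < \<gamma>" "\<gamma> < 1"
    and decay: "\<And>q x. x \<in> X \<Longrightarrow> Z s (reduced k J q) x \<le> K ^ 2 * \<gamma> ^ q"
    using reduced_decay[OF less_imp_le[OF s] K bounds J] by auto
  have rep: "Z s (representatives k J n) x \<le> K ^ 3 * \<gamma> ^ (n div k)" for n
  proof -
    have "Z s (representatives k J n) x \<le> K ^ 2 * \<gamma> ^ (n div k) * Z s (words D (n mod k)) x"
      unfolding representatives_def
      by (rule Z_concat_le[OF reduced_subset order_refl x decay])
    also have "\<dots> \<le> K ^ 2 * \<gamma> ^ (n div k) * K"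
      by (rule mult_left_mono) (use bounds[OF x] K \<gamma> in auto)
    finally show ?thesis by (simp add: power2_eq_square power3_eq_cube mult_ac)
  qed
  \<comment> \<open>The second term makes the factor \<open>\<kappa>\<^bsup>-n e\<^esup>\<close> use up half of the decay \<open>\<gamma>\<^bsup>n/k\<^esup>\<close>.\<close>
  define e where "e = min (s / 2) (ln \<gamma> / (2 * real k * ln \<kappa>))"
  have ln\<kappa>: "ln \<kappa> < 0" and ln\<gamma>: "ln \<gamma> < 0" using \<kappa>_pos \<kappa>_less_1 \<gamma> by auto
  have "0 < ln \<gamma> / (2 * real k * ln \<kappa>)"
    using ln\<kappa> ln\<gamma> k by (intro divide_neg_neg) (auto simp: mult_less_0_iff)
  then have e: "0 < e" "e < s" using s by (auto simp: e_def)
  have "summable (\<lambda>n. Z t (representatives k J n) x)" if t: "t \<in> {s - e..s}" for t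
  proof -
    have half: "a + w \<le> w / 2" if "a \<le> - w / 2" for a w :: real using that by simp
    define \<mu> where "\<mu> = exp (- (s - t) * ln \<kappa> + ln \<gamma> / real k)"
    have "s - t \<le> ln \<gamma> / (2 * real k * ln \<kappa>)" using t by (auto simp: e_def)
    then have "(s - t) * (- ln \<kappa>) \<le> ln \<gamma> / (2 * real k * ln \<kappa>) * (- ln \<kappa>)"
      by (rule mult_right_mono) (use ln\<kappa> in auto)
    also have "\<dots> = - (ln \<gamma> / real k) / 2" using ln\<kappa> by (simp add: field_simps)
    finally have "(s - t) * (- ln \<kappa>) + ln \<gamma> / real k \<le> ln \<gamma> / real k / 2"
      by (rule half)
    moreover have "- (s - t) * ln \<kappa> = (s - t) * (- ln \<kappa>)"
      by (rule minus_mult_commute)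
    ultimately have "- (s - t) * ln \<kappa> + ln \<gamma> / real k \<le> ln \<gamma> / real k / 2"
      by (simp only:)
    also have "\<dots> < 0" using ln\<gamma> k by (simp add: divide_neg_pos)
    finally have \<mu>: "0 < \<mu>" "\<mu> < 1" by (simp_all add: \<mu>_def)
    have bound: "Z t (representatives k J n) x \<le> K ^ 3 / \<gamma> * \<mu> ^ n" for n
    proof -
      \<comment> \<open>Rounding \<open>n / k\<close> down costs one factor \<open>1 / \<gamma>\<close>.\<close>
      have "real (n mod k) \<le> real k" using k by (simp add: less_imp_le)
      moreover have "real n = real k * real (n div k) + real (n mod k)"
        by (metis mult_div_mod_eq of_nat_add of_nat_mult)
      ultimately have "real n \<le> real k * (real (n div k) + 1)" by (simp add: algebra_simps)
      then have "real n / real k - 1 \<le> real (n div k)" using k by (simp add: field_simps)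
      then have "real (n div k) * ln \<gamma> \<le> (real n / real k - 1) * ln \<gamma>"
        using ln\<gamma> by (simp add: mult_right_mono_neg)
      then have "exp (real (n div k) * ln \<gamma>) \<le> exp (real n * (ln \<gamma> / real k) - ln \<gamma>)"
        by (simp add: algebra_simps)
      then have pow: "\<gamma> ^ (n div k) \<le> exp (real n * (ln \<gamma> / real k)) / \<gamma>"
        using \<gamma> by (simp add: exp_of_nat_mult exp_diff)
      have "(\<kappa> ^ n) powr (s - t) * Z t (representatives k J n) x \<le> Z s (representatives k J n) x"
        by (rule Z_exponent_lower[OF representatives_subset x]) (use t in auto)
      also have "\<dots> \<le> K ^ 3 * \<gamma> ^ (n div k)" by (rule rep)
      also have "\<dots> \<le> K ^ 3 * (exp (real n * (ln \<gamma> / real k)) / \<gamma>)"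
        by (rule mult_left_mono[OF pow]) (use K in auto)
      finally have *: "(\<kappa> ^ n) powr (s - t) * Z t (representatives k J n) x
          \<le> K ^ 3 / \<gamma> * exp (real n * (ln \<gamma> / real k))" by simp
      have "(\<kappa> ^ n) powr (s - t) = exp (real n * ((s - t) * ln \<kappa>))"
        using \<kappa>_pos by (simp add: powr_def ln_realpow mult_ac)
      then have "Z t (representatives k J n) x
          = exp (- (real n * ((s - t) * ln \<kappa>))) * ((\<kappa> ^ n) powr (s - t) * Z t (representatives k J n) x)"
        by (simp flip: mult.assoc exp_add)
      also have "\<dots> \<le> exp (- (real n * ((s - t) * ln \<kappa>)))
          * (K ^ 3 / \<gamma> * exp (real n * (ln \<gamma> / real k)))"
        by (rule mult_left_mono[OF *]) simp
      also have "\<dots> = K ^ 3 / \<gamma> * exp (real n * (- (s - t) * ln \<kappa> + ln \<gamma> / real k))"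
        by (simp add: algebra_simps exp_diff exp_add exp_minus)
      also have "\<dots> = K ^ 3 / \<gamma> * \<mu> ^ n" unfolding \<mu>_def exp_of_nat_mult ..
      finally show ?thesis .
    qed
    have "summable (\<lambda>n. K ^ 3 / \<gamma> * \<mu> ^ n)"
      by (intro summable_mult summable_geometric) (use \<mu> in auto)
    then show ?thesis
      by (rule summable_comparison_test') (use bound in \<open>auto simp: Z_nonneg\<close>)
  qed
  then show ?thesis using e by (intro bexI[of _ e]) auto
qed

text \<open>
  Replace every block \<open>J\<close> by \<open>J'\<close>; by the overlap this does not change the composition on \<open>X\<close>.
\<close>

lemma reduced_represents:
  assumes J: "J \<in> words D k" "J' \<in> words D k" "J' \<noteq> J"
    and eq: "\<And>x. x \<in> X \<Longrightarrow> word_map \<phi> J x = word_map \<phi> J' x"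
    and I: "I \<in> words D (q * k)"
  shows "\<exists>I'\<in>reduced k J q. \<forall>x\<in>X. word_map \<phi> I' x = word_map \<phi> I x"
  using I
proof (induction q arbitrary: I)
  case (Suc q)
  then have "I \<in> concat_sets (words D (q * k)) (words D k)"
    by (simp add: concat_sets_words add.commute)
  then obtain M L where M: "M \<in> words D (q * k)" and L: "L \<in> words D k" and I: "I = M @ L"
    by (auto simp: concat_sets_def)
  obtain M' where M': "M' \<in> reduced k J q" "\<And>x. x \<in> X \<Longrightarrow> word_map \<phi> M' x = word_map \<phi> M x"
    using Suc.IH[OF M] by auto
  define L' where "L' = (if L = J then J' else L)"
  have L': "L' \<in> words D k - {J}" "\<And>x. x \<in> X \<Longrightarrow> word_map \<phi> L' x = word_map \<phi> L x"
    using L J eq by (auto simp: L'_def)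
  have "M' @ L' \<in> reduced k J (Suc q)"
    using M'(1) L'(1) unfolding reduced.simps concat_sets_def by blast
  moreover have "word_map \<phi> (M' @ L') x = word_map \<phi> I x" if "x \<in> X" for x
    using that M'(2) L'(2) word_map_X[of L x] L by (simp add: I word_map_append words_def)
  ultimately show ?case by blast
qed auto

lemma representatives_represent:
  assumes J: "J \<in> words D k" "J' \<in> words D k" "J' \<noteq> J"
    and eq: "\<And>x. x \<in> X \<Longrightarrow> word_map \<phi> J x = word_map \<phi> J' x"
    and I: "I \<in> words D n"
  shows "\<exists>I'\<in>representatives k J n. \<forall>x\<in>X. word_map \<phi> I' x = word_map \<phi> I x"
proof -
  have "I \<in> concat_sets (words D (n div k * k)) (words D (n mod k))"
    using I by (simp add: concat_sets_words)
  then obtain M L where M: "M \<in> words D (n div k * k)" and L: "L \<in> words D (n mod k)"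
    and I: "I = M @ L"
    by (auto simp: concat_sets_def)
  obtain M' where M': "M' \<in> reduced k J (n div k)" "\<And>x. x \<in> X \<Longrightarrow> word_map \<phi> M' x = word_map \<phi> M x"
    using reduced_represents[OF J eq M] by auto
  have "M' @ L \<in> representatives k J n"
    using M'(1) L unfolding representatives_def concat_sets_def by blast
  moreover have "word_map \<phi> (M' @ L) x = word_map \<phi> I x" if "x \<in> X" for x
    using that M'(2) word_map_X[of L x] L by (simp add: I word_map_append words_def)
  ultimately show ?thesis by blast
qed

end

section \<open>Conformal maps\<close>

text \<open>
  Here \<open>a\<close> is the scaling factor of the derivative; this form composes well under the chain rule.
\<close>

definition conformal_at :: "('a::euclidean_space \<Rightarrow> 'a) \<Rightarrow> 'a \<Rightarrow> real \<Rightarrow> bool" where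
  "conformal_at f x a \<longleftrightarrow>
     (\<exists>f'. (f has_derivative f') (at x) \<and> (\<forall>v. norm (f' v) = a * norm v))"

lemma onorm_similarity:
  fixes f :: "'a::euclidean_space \<Rightarrow> 'a"
  assumes "\<And>v. norm (f v) = a * norm v"
  shows "onorm f = a"
proof -
  obtain b :: 'a where "b \<in> Basis" using nonempty_Basis by blast
  then have b: "norm b = 1" by simp
  have a: "0 \<le> a" using assms[of b] b by (metis mult.right_neutral norm_ge_zero)
  have "norm (f v) / norm v \<le> a" for v using assms[of v] a by (cases "v = 0") auto
  moreover have "norm (f b) / norm b = a" using assms[of b] b by simp
  ultimately show ?thesis
    unfolding onorm_def by (intro cSup_eq_maximum) (auto intro: rev_image_eqI)
qed

lemma conformal_at_deriv_norm: "conformal_at f x a \<Longrightarrow> deriv_norm f x = a"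
  unfolding conformal_at_def deriv_norm_def
  using onorm_similarity frechet_derivative_at by metis

lemma conformal_at_nonneg:
  assumes "conformal_at f x a"
  shows "0 \<le> a"
proof -
  obtain b :: 'a where "b \<in> Basis" using nonempty_Basis by blast
  then have "norm b = 1" by simp
  then show ?thesis
    using assms unfolding conformal_at_def by (metis mult.right_neutral norm_ge_zero)
qed

lemma conformal_at_compose:
  assumes "conformal_at f x a" "conformal_at g (f x) b"
  shows "conformal_at (g \<circ> f) x (b * a)"
proof -
  obtain f' where f: "(f has_derivative f') (at x)" "\<And>v. norm (f' v) = a * norm v"
    using assms(1) unfolding conformal_at_def by blast
  obtain g' where g: "(g has_derivative g') (at (f x))" "\<And>v. norm (g' v) = b * norm v"
    using assms(2) unfolding conformal_at_def by blast
  have "(g \<circ> f has_derivative g' \<circ> f') (at x)" by (rule diff_chain_at[OF f(1) g(1)])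
  moreover have "norm ((g' \<circ> f') v) = b * a * norm v" for v by (simp add: f(2) g(2))
  ultimately show ?thesis unfolding conformal_at_def by blast
qed

lemma conformal_on_imp_conformal_at:
  assumes "conformal_on V f" "x \<in> V"
  shows "conformal_at f x (deriv_norm f x)"
proof -
  obtain f' where "(f has_derivative blinfun_apply (f' x)) (at x)"
      "\<And>y. norm (blinfun_apply (f' x) y) = norm (f' x) * norm y"
    using assms unfolding conformal_on_def by metis
  then have "conformal_at f x (norm (f' x))" unfolding conformal_at_def by blast
  with conformal_at_deriv_norm[OF this] show ?thesis by simp
qed

lemma conformal_lipschitz_ball:
  assumes conf: "\<And>y. y \<in> ball x R \<Longrightarrow> conformal_at f y (a y)"
    and le: "\<And>y. y \<in> ball x R \<Longrightarrow> a y \<le> b" and y: "y \<in> ball x R"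
  shows "dist (f x) (f y) \<le> b * dist x y"
proof -
  have "\<forall>z\<in>ball x R. \<exists>f'. (f has_derivative f') (at z) \<and> (\<forall>v. norm (f' v) = a z * norm v)"
    using conf unfolding conformal_at_def by blast
  then obtain F where F: "\<And>z. z \<in> ball x R \<Longrightarrow> (f has_derivative F z) (at z)"
      "\<And>z v. z \<in> ball x R \<Longrightarrow> norm (F z v) = a z * norm v"
    by metis
  have "norm (f x - f y) \<le> b * norm (x - y)"
  proof (rule differentiable_bound[of "ball x R" f F])
    show "onorm (F z) \<le> b" if "z \<in> ball x R" for z
      using onorm_similarity[OF F(2)[OF that]] le[OF that] by simp
    show "x \<in> ball x R" using y by (auto intro: le_less_trans[OF zero_le_dist])
  qed (use F(1) y in \<open>auto intro: has_derivative_at_withinI\<close>)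
  then show ?thesis by (simp add: dist_norm)
qed

text \<open>
  The inverse of \<open>f\<close> is \<open>1/m\<close>-Lipschitz on every ball around \<open>f x\<close> inside the image \<open>O'\<close> of \<open>ball x R\<close>, so
  the claim holds near \<open>f x\<close>; the point is that \<open>O'\<close> contains the ball of radius \<open>m R\<close>.  Otherwise
  take a nearest point \<open>w\<close> outside \<open>O'\<close>, at distance \<open>t < m R\<close>.  The ball of radius \<open>t\<close> lies in the
  image of \<open>cball x (t/m)\<close>; this image is compact, so it contains \<open>w\<close> as well, a contradiction.  By
  injectivity, points outside \<open>ball x R\<close> are mapped outside the ball of radius \<open>m R\<close>.
\<close>

lemma conformal_expansion:
  fixes f :: "'a::euclidean_space \<Rightarrow> 'a"
  assumes inj: "inj_on f U" and sub: "ball x R \<subseteq> U" and R: "0 < R" and m: "0 < m"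
    and conf: "\<And>y. y \<in> ball x R \<Longrightarrow> conformal_at f y (a y)"
    and ge: "\<And>y. y \<in> ball x R \<Longrightarrow> m \<le> a y" and y: "y \<in> U"
  shows "m * min (dist x y) R \<le> dist (f x) (f y)"
proof -
  let ?B = "ball x R"
  define O' where "O' = f ` ?B"
  define h where "h = inv_into ?B f"
  have xB: "x \<in> ?B" using R by simp
  have injB: "inj_on f ?B" using inj sub by (rule inj_on_subset)
  have hf: "h (f z) = z" if "z \<in> ?B" for z
    unfolding h_def by (rule inv_into_f_f[OF injB that])
  have fh: "h w \<in> ?B" "f (h w) = w" if "w \<in> O'" for w
    using that hf by (auto simp: O'_def)
  have contf: "continuous_on ?B f"
    using conf unfolding conformal_at_def
    by (intro continuous_at_imp_continuous_on) (blast dest: has_derivative_continuous)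
  have openO: "open O'" unfolding O'_def by (rule invariance_of_domain[OF contf open_ball injB])
  have derh: "\<exists>h'. (h has_derivative h') (at w) \<and> onorm h' \<le> 1 / m" if w: "w \<in> O'" for w
  proof -
    obtain f' where f': "(f has_derivative f') (at (h w))" "\<And>v. norm (f' v) = a (h w) * norm v"
      using conf[OF fh(1)[OF w]] unfolding conformal_at_def by blast
    have a: "m \<le> a (h w)" by (rule ge[OF fh(1)[OF w]])
    have lin: "linear f'" using f'(1) has_derivative_linear by blast
    have "inj f'"
      unfolding linear_injective_0[OF lin] using f'(2) a m
      by (metis less_le_trans mult_eq_0_iff norm_eq_zero norm_zero order_less_irrefl)
    then obtain h' where h': "linear h'" "\<And>v. h' (f' v) = v" "\<And>v. f' (h' v) = v"
      using linear_injective_isomorphism[OF lin] by blast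
    have "(h has_derivative h') (at (f (h w)))"
      by (rule has_derivative_inverse_strong[OF open_ball fh(1)[OF w] contf hf f'(1)])
         (use h' in auto)
    moreover have "onorm h' \<le> 1 / m"
    proof (rule onorm_bound)
      fix v
      have "m * norm (h' v) \<le> a (h w) * norm (h' v)" by (rule mult_right_mono[OF a]) simp
      also have "\<dots> = norm v" using f'(2)[of "h' v"] h'(3) by simp
      finally show "norm (h' v) \<le> 1 / m * norm v" using m by (simp add: field_simps)
    qed (use m in auto)
    ultimately show ?thesis using fh(2)[OF w] by auto
  qed
  then obtain H where H: "\<And>w. w \<in> O' \<Longrightarrow> (h has_derivative H w) (at w)"
      "\<And>w. w \<in> O' \<Longrightarrow> onorm (H w) \<le> 1 / m"
    by metis
  have contract: "m * dist x (h w) \<le> dist (f x) w"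
    if t: "ball (f x) t \<subseteq> O'" and w: "w \<in> ball (f x) t" for t w
  proof -
    have "norm (h (f x) - h w) \<le> 1 / m * norm (f x - w)"
    proof (rule differentiable_bound[of "ball (f x) t" h H])
      show "f x \<in> ball (f x) t" using w by (auto intro: le_less_trans[OF zero_le_dist])
      show "(h has_derivative H v) (at v within ball (f x) t)" "onorm (H v) \<le> 1 / m"
        if "v \<in> ball (f x) t" for v
        using that t H has_derivative_at_withinI by blast+
    qed (use w in simp_all)
    then show ?thesis using hf[OF xB] m by (simp add: dist_norm field_simps)
  qed
  have inside: "ball (f x) (m * R) \<subseteq> O'"
  proof (rule ccontr)
    assume "\<not> ?thesis"
    then obtain w0 where w0: "w0 \<in> - O'" "dist (f x) w0 < m * R"
      unfolding subset_eq by auto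
    then have "- O' \<noteq> {}" by blast
    then obtain w where w: "w \<in> - O'" "infdist (f x) (- O') = dist (f x) w"
      using infdist_attains_inf[of "- O'" "f x"] openO by (auto simp: closed_Compl)
    define t where "t = dist (f x) w"
    have "t \<le> dist (f x) w0" unfolding t_def w(2)[symmetric] by (rule infdist_le[OF w0(1)])
    then have t: "t < m * R" using w0 by simp
    have "t \<noteq> 0" using w(1) xB by (auto simp: t_def O'_def)
    then have t_pos: "0 < t" by (simp add: t_def)
    have sub_t: "ball (f x) t \<subseteq> O'"
    proof
      fix v assume "v \<in> ball (f x) t"
      then show "v \<in> O'" using infdist_le[of v "- O'" "f x"] w(2) by (force simp: t_def)
    qed
    let ?K = "f ` cball x (t / m)"
    have tm: "t / m < R" using t m by (simp add: field_simps)
    have "cball x (t / m) \<subseteq> ?B" using tm by auto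
    then have KO: "?K \<subseteq> O'" and "compact ?K"
      using continuous_on_subset[OF contf] by (auto simp: O'_def intro!: compact_continuous_image)
    have "ball (f x) t \<subseteq> ?K"
    proof
      fix v assume v: "v \<in> ball (f x) t"
      have "dist x (h v) \<le> t / m" using contract[OF sub_t v] v m by (simp add: field_simps)
      then show "v \<in> ?K" using fh(2)[of v] sub_t v by (metis imageI mem_cball subsetD)
    qed
    then have "closure (ball (f x) t) \<subseteq> ?K"
      using \<open>compact ?K\<close> by (intro closure_minimal compact_imp_closed)
    then have "w \<in> ?K" using t_pos by (auto simp: closure_ball t_def)
    then show False using w(1) KO by blast
  qed
  show ?thesis
  proof (cases "dist (f x) (f y) < m * R")
    case True
    then have fy: "f y \<in> ball (f x) (m * R)" by simp
    then have "f y \<in> O'" using inside by blast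
    then obtain p where p: "p \<in> ?B" "f y = f p" by (auto simp: O'_def)
    then have "y = p" using inj y sub by (meson inj_onD subsetD)
    then have "h (f y) = y" using hf p by simp
    then have "m * dist x y \<le> dist (f x) (f y)" using contract[OF inside fy] by simp
    moreover have "m * min (dist x y) R \<le> m * dist x y" using m by simp
    ultimately show ?thesis by linarith
  next
    case False
    moreover have "m * min (dist x y) R \<le> m * R" using m by simp
    ultimately show ?thesis by linarith
  qed
qed

section \<open>Derivatives and diameters of cylinder sets\<close>

text \<open>
  The conformal extensions need not map their domain into itself, so compositions are studied on a
  smaller set \<open>U\<close>, which is invariant and contains a ball of fixed radius around each point of \<open>X\<close>.
\<close>

locale conformal_neighbourhood =
  fixes D :: "'i set" and \<phi> :: "'i \<Rightarrow> 'a \<Rightarrow> 'a::euclidean_space" and X U :: "'a set"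
    and \<epsilon> \<rho> \<kappa> r c \<alpha> :: real
  assumes finite_D: "finite D" and card_D: "2 \<le> card D"
    and X_nonempty: "X \<noteq> {}" and bounded_U: "bounded U"
    and ball_U: "x \<in> X \<Longrightarrow> ball x \<epsilon> \<subseteq> U" and \<epsilon>_pos: "0 < \<epsilon>"
    and X_invariant: "i \<in> D \<Longrightarrow> x \<in> X \<Longrightarrow> \<phi> i x \<in> X"
    and U_invariant: "i \<in> D \<Longrightarrow> x \<in> U \<Longrightarrow> \<phi> i x \<in> U"
    and inj: "i \<in> D \<Longrightarrow> inj_on (\<phi> i) U"
    and contract: "i \<in> D \<Longrightarrow> x \<in> U \<Longrightarrow> y \<in> U \<Longrightarrow> dist (\<phi> i x) (\<phi> i y) \<le> \<rho> * dist x y"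
    and \<rho>: "0 < \<rho>" "\<rho> < 1"
    and conformal: "i \<in> D \<Longrightarrow> x \<in> U \<Longrightarrow> conformal_at (\<phi> i) x (deriv_norm (\<phi> i) x)"
    and deriv_ge: "i \<in> D \<Longrightarrow> x \<in> U \<Longrightarrow> \<kappa> \<le> deriv_norm (\<phi> i) x"
    and deriv_le: "i \<in> D \<Longrightarrow> x \<in> U \<Longrightarrow> deriv_norm (\<phi> i) x \<le> r"
    and \<kappa>_pos: "0 < \<kappa>" and r_less_1: "r < 1"
    and hoelder: "i \<in> D \<Longrightarrow> x \<in> U \<Longrightarrow> y \<in> U \<Longrightarrow>
          deriv_norm (\<phi> i) x \<le> deriv_norm (\<phi> i) y + c * dist x y powr \<alpha>"
    and c_pos: "0 < c" and \<alpha>_pos: "0 < \<alpha>"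
begin

definition g :: "'i list \<Rightarrow> 'a \<Rightarrow> real" where
  "g I x = deriv_norm (word_map \<phi> I) x"

lemma X_U: "X \<subseteq> U"
  using ball_U \<epsilon>_pos by fastforce

lemma word_map_U: "set I \<subseteq> D \<Longrightarrow> x \<in> U \<Longrightarrow> word_map \<phi> I x \<in> U"
  by (rule word_map_in[of D U]) (use U_invariant in auto)

lemma word_map_in_X: "set I \<subseteq> D \<Longrightarrow> x \<in> X \<Longrightarrow> word_map \<phi> I x \<in> X"
  by (rule word_map_in[of D X]) (use X_invariant in auto)

lemma word_map_contract:
  assumes "set I \<subseteq> D" "x \<in> U" "y \<in> U"
  shows "dist (word_map \<phi> I x) (word_map \<phi> I y) \<le> \<rho> ^ length I * dist x y"
  using assms(1)
proof (induction I)
  case (Cons i I)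
  have "dist (word_map \<phi> (i # I) x) (word_map \<phi> (i # I) y)
      \<le> \<rho> * dist (word_map \<phi> I x) (word_map \<phi> I y)"
    using contract[of i "word_map \<phi> I x" "word_map \<phi> I y"] word_map_U[of I] Cons.prems assms
    by simp
  also have "\<dots> \<le> \<rho> * (\<rho> ^ length I * dist x y)"
    by (rule mult_left_mono) (use Cons \<rho> in auto)
  finally show ?case by simp
qed simp

lemma word_map_inj:
  assumes "set I \<subseteq> D"
  shows "inj_on (word_map \<phi> I) U"
  using assms
proof (induction I)
  case (Cons i I)
  then have "word_map \<phi> I ` U \<subseteq> U" using word_map_U[of I] by auto
  then have "inj_on (\<phi> i) (word_map \<phi> I ` U)"
    by (rule inj_on_subset[OF inj, rotated]) (use Cons.prems in simp)
  then have "inj_on (\<phi> i \<circ> word_map \<phi> I) U"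
    using Cons by (intro comp_inj_on) simp_all
  then show ?case unfolding word_map_Cons .
qed simp

lemma word_map_conformal:
  assumes "set I \<subseteq> D" "x \<in> U"
  shows "conformal_at (word_map \<phi> I) x (g I x)"
proof -
  have "\<exists>a. conformal_at (word_map \<phi> I) x a" using assms(1)
  proof (induction I)
    case Nil
    have "(id has_derivative id) (at x)" by (simp add: id_def)
    then have "conformal_at (word_map \<phi> []) x 1"
      unfolding conformal_at_def by (intro exI[of _ id]) auto
    then show ?case by blast
  next
    case (Cons i I)
    then obtain a where "conformal_at (word_map \<phi> I) x a" by auto
    moreover have "conformal_at (\<phi> i) (word_map \<phi> I x) (deriv_norm (\<phi> i) (word_map \<phi> I x))"
      by (rule conformal) (use Cons.prems word_map_U[of I x] assms(2) in auto)
    ultimately show ?case unfolding word_map_Cons using conformal_at_compose by blast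
  qed
  then show ?thesis using conformal_at_deriv_norm unfolding g_def by metis
qed

lemma g_append_U:
  assumes "set I \<subseteq> D" "set J \<subseteq> D" "x \<in> U"
  shows "g (I @ J) x = g I (word_map \<phi> J x) * g J x"
proof -
  have "conformal_at (word_map \<phi> (I @ J)) x (g I (word_map \<phi> J x) * g J x)"
    unfolding word_map_append
    by (intro conformal_at_compose word_map_conformal word_map_U assms)
  then show ?thesis unfolding g_def by (rule conformal_at_deriv_norm)
qed

lemma g_single: "g [i] x = deriv_norm (\<phi> i) x"
  by (simp add: g_def)

lemma g_Cons:
  assumes "i \<in> D" "set I \<subseteq> D" "x \<in> U"
  shows "g (i # I) x = deriv_norm (\<phi> i) (word_map \<phi> I x) * g I x"
  using g_append_U[of "[i]" I x] assms by (simp add: g_single)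

lemma g_Nil_U: "x \<in> U \<Longrightarrow> g [] x = 1"
proof -
  assume "x \<in> U"
  have "(id has_derivative id) (at x)" by (simp add: id_def)
  then have "conformal_at (word_map \<phi> []) x 1"
    unfolding conformal_at_def by (intro exI[of _ id]) auto
  then show ?thesis unfolding g_def by (rule conformal_at_deriv_norm)
qed

lemma g_bounds:
  assumes "set I \<subseteq> D" "x \<in> U"
  shows "\<kappa> ^ length I \<le> g I x" "g I x \<le> r ^ length I"
proof -
  have "\<kappa> ^ length I \<le> g I x \<and> g I x \<le> r ^ length I" using assms(1)
  proof (induction I)
    case (Cons i I)
    have U: "word_map \<phi> I x \<in> U" using Cons.prems word_map_U assms(2) by simp
    have i: "i \<in> D" and I: "set I \<subseteq> D" using Cons.prems by auto
    have "0 < g I x" using Cons.IH[OF I] \<kappa>_pos by (meson less_le_trans zero_less_power)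
    moreover have "0 < deriv_norm (\<phi> i) (word_map \<phi> I x)"
      using deriv_ge[OF i U] \<kappa>_pos by linarith
    ultimately show ?case
      using Cons.IH[OF I] deriv_ge[OF i U] deriv_le[OF i U] \<kappa>_pos
      unfolding g_Cons[OF i I assms(2)] by (auto intro!: mult_mono)
  qed (simp add: g_Nil_U assms(2))
  then show "\<kappa> ^ length I \<le> g I x" "g I x \<le> r ^ length I" by auto
qed

lemma g_pos_U: "set I \<subseteq> D \<Longrightarrow> x \<in> U \<Longrightarrow> 0 < g I x"
  using g_bounds(1)[of I x] \<kappa>_pos by (meson less_le_trans zero_less_power)

definition C where "C = exp (c / \<kappa> * diameter U powr \<alpha> / (1 - \<rho> powr \<alpha>))"

text \<open>
  Along the orbits of two points under the suffixes of a word the distances decrease like \<open>\<rho>\<^sup>j\<close>, so by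
  Hoelder continuity the ratios of the derivative norms differ from \<open>1\<close> by at most the terms of a
  geometric series.
\<close>

lemma g_distortion:
  assumes "set I \<subseteq> D" "x \<in> U" "y \<in> U"
  shows "g I x \<le> C * g I y"
proof -
  define b where "b = c / \<kappa> * diameter U powr \<alpha>"
  have b: "0 \<le> b" using c_pos \<kappa>_pos by (simp add: b_def)
  define q where "q = \<rho> powr \<alpha>"
  have q: "0 < q" "q < 1"
    using \<rho> \<alpha>_pos powr_less_mono2[of \<alpha> \<rho> 1] by (auto simp: q_def)
  have "g I x \<le> exp (b * (\<Sum>j<length I. q ^ j)) * g I y" using assms(1)
  proof (induction I)
    case (Cons i I)
    have i: "i \<in> D" and I: "set I \<subseteq> D" using Cons.prems by auto
    let ?n = "length I" and ?u = "word_map \<phi> I x" and ?v = "word_map \<phi> I y"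
    have U: "?u \<in> U" "?v \<in> U" using word_map_U I assms by auto
    let ?d = "deriv_norm (\<phi> i)"
    have d_pos: "\<kappa> \<le> ?d ?v" "0 < ?d ?v" using deriv_ge[OF i U(2)] \<kappa>_pos by auto
    have "dist ?u ?v powr \<alpha> \<le> (\<rho> ^ ?n * diameter U) powr \<alpha>"
    proof (rule powr_mono2)
      have "dist ?u ?v \<le> \<rho> ^ ?n * dist x y" by (rule word_map_contract[OF I assms(2,3)])
      also have "\<dots> \<le> \<rho> ^ ?n * diameter U"
        by (rule mult_left_mono) (use diameter_bounded_bound[OF bounded_U assms(2,3)] \<rho> in auto)
      finally show "dist ?u ?v \<le> \<rho> ^ ?n * diameter U" .
    qed (use \<alpha>_pos in auto)
    also have "\<dots> = q ^ ?n * diameter U powr \<alpha>"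
      using \<rho> diameter_ge_0[OF bounded_U]
      by (simp add: powr_mult q_def powr_powr mult.commute flip: powr_realpow)
    finally have dist_le: "dist ?u ?v powr \<alpha> \<le> q ^ ?n * diameter U powr \<alpha>" .
    have "?d ?u \<le> ?d ?v + c * dist ?u ?v powr \<alpha>" by (rule hoelder[OF i U])
    also have "\<dots> \<le> ?d ?v + c * (q ^ ?n * diameter U powr \<alpha>)"
      using dist_le c_pos by simp
    also have "\<dots> = ?d ?v + \<kappa> * (b * q ^ ?n)" using \<kappa>_pos by (simp add: b_def)
    also have "\<dots> \<le> ?d ?v + ?d ?v * (b * q ^ ?n)"
      by (intro add_left_mono mult_right_mono) (use d_pos b q in auto)
    also have "\<dots> = (1 + b * q ^ ?n) * ?d ?v" by (simp add: algebra_simps)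
    \<comment> \<open>The additive error becomes a factor, so that the errors of all letters multiply.\<close>
    also have "\<dots> \<le> exp (b * q ^ ?n) * ?d ?v"
      by (rule mult_right_mono[OF exp_ge_add_one_self]) (use d_pos in auto)
    finally have "?d ?u \<le> exp (b * q ^ ?n) * ?d ?v" .
    then have "?d ?u * g I x
        \<le> (exp (b * q ^ ?n) * ?d ?v) * (exp (b * (\<Sum>j<?n. q ^ j)) * g I y)"
      by (intro mult_mono Cons.IH I) (use d_pos g_pos_U[OF I assms(2)] in auto)
    also have "\<dots> = exp (b * (\<Sum>j<Suc ?n. q ^ j)) * (?d ?v * g I y)"
      by (simp add: algebra_simps exp_add)
    finally show ?case using g_Cons[OF i I] assms by simp
  qed (simp add: g_Nil_U assms)
  also have "\<dots> \<le> C * g I y"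
  proof (rule mult_right_mono)
    have "(\<Sum>j<length I. q ^ j) \<le> (\<Sum>j. q ^ j)"
      by (rule sum_le_suminf) (use q in \<open>auto intro: summable_geometric\<close>)
    also have "\<dots> = 1 / (1 - q)" by (rule suminf_geometric) (use q in auto)
    finally have "b * (\<Sum>j<length I. q ^ j) \<le> b * (1 / (1 - q))" by (rule mult_left_mono[OF _ b])
    then show "exp (b * (\<Sum>j<length I. q ^ j)) \<le> C" by (simp add: C_def b_def q_def)
  qed (use g_pos_U[OF assms(1,3)] in simp)
  finally show ?thesis .
qed

sublocale cocycle D \<phi> X g \<kappa> r C
proof
  show "g (I @ J) x = g I (word_map \<phi> J x) * g J x"
    if "set I \<subseteq> D" "set J \<subseteq> D" "x \<in> X" for I J x
    using g_append_U that X_U by blast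
  show "\<kappa> ^ length I \<le> g I x" "g I x \<le> r ^ length I" if "set I \<subseteq> D" "x \<in> X" for I x
    using g_bounds that X_U by auto
  show "g I x \<le> C * g I y" if "set I \<subseteq> D" "x \<in> X" "y \<in> X" for I x y
    using g_distortion that X_U by blast
qed (use finite_D X_nonempty X_invariant \<kappa>_pos r_less_1 card_D in auto)

lemma bounded_X: "bounded X"
  using bounded_U X_U bounded_subset by blast

lemma word_image_subset: "set I \<subseteq> D \<Longrightarrow> word_map \<phi> I ` X \<subseteq> X"
  using word_map_in_X by blast

text \<open>
  Two points of \<open>X\<close> are fixed, and \<open>conformal_expansion\<close> keeps their images apart at the scale of
  \<open>g I\<close>; the factor \<open>C\<^sup>2\<close> pays for distortion inside the ball around \<open>x\<close> and for the change of base
  point to \<open>w\<close>.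
\<close>

lemma diameter_lower:
  assumes "x \<in> X" "y \<in> X" "x \<noteq> y"
  shows "\<exists>b>0. \<forall>I w. set I \<subseteq> D \<longrightarrow> w \<in> X \<longrightarrow> b * g I w \<le> diameter (word_map \<phi> I ` X)"
proof (intro exI conjI allI impI)
  have C: "0 < C" by (simp add: C_def)
  define b where "b = min (dist x y) \<epsilon> / C ^ 2"
  show "0 < b" using assms(3) \<epsilon>_pos C by (simp add: b_def)
  fix I w assume I: "set I \<subseteq> D" and w: "w \<in> X"
  have U: "x \<in> U" "y \<in> U" "w \<in> U" using assms w X_U by auto
  have "g I w / C \<le> g I x" using g_distortion[OF I U(3) U(1)] C by (simp add: field_simps)
  then have "g I w / C ^ 2 \<le> g I x / C"
    using C by (simp add: power2_eq_square field_simps)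
  then have "b * g I w \<le> g I x / C * min (dist x y) \<epsilon>"
    using mult_right_mono[of "g I w / C ^ 2" "g I x / C" "min (dist x y) \<epsilon>"] \<epsilon>_pos
    by (simp add: b_def mult_ac)
  also have "\<dots> \<le> dist (word_map \<phi> I x) (word_map \<phi> I y)"
  proof (rule conformal_expansion[OF word_map_inj[OF I] ball_U[OF assms(1)] \<epsilon>_pos])
    show "0 < g I x / C" using g_pos_U[OF I U(1)] C by simp
    fix z assume z: "z \<in> ball x \<epsilon>"
    then have zU: "z \<in> U" using ball_U assms(1) by blast
    show "conformal_at (word_map \<phi> I) z (g I z)" by (rule word_map_conformal[OF I zU])
    show "g I x / C \<le> g I z" using g_distortion[OF I U(1) zU] C by (simp add: field_simps)
  qed (rule U(2))
  also have "\<dots> \<le> diameter (word_map \<phi> I ` X)"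
    using word_image_subset[OF I] bounded_X bounded_subset assms
    by (intro diameter_bounded_bound) auto
  finally show "b * g I w \<le> diameter (word_map \<phi> I ` X)" .
qed

text \<open>
  On a ball inside \<open>U\<close> the mean value inequality and distortion give the bound, but \<open>X\<close> need not lie in
  such a ball.  After \<open>m\<close> contractions the image of \<open>X\<close> does, so for a long word the last \<open>m\<close> letters
  are split off; for the finitely many shorter lengths \<open>g\<close> is at least \<open>\<kappa>\<^sup>m\<close>.
\<close>

lemma diameter_upper:
  "\<exists>b>0. \<forall>I w. set I \<subseteq> D \<longrightarrow> w \<in> X \<longrightarrow> diameter (word_map \<phi> I ` X) \<le> b * g I w"
proof -
  have C: "1 \<le> C" by (rule C_ge_1)
  have "(\<lambda>n. \<rho> ^ n * diameter U) \<longlonglongrightarrow> 0 * diameter U"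
    by (intro tendsto_mult tendsto_const LIMSEQ_realpow_zero) (use \<rho> in auto)
  then have "eventually (\<lambda>n. \<rho> ^ n * diameter U < \<epsilon>) sequentially"
    using \<epsilon>_pos by (auto dest!: order_tendstoD(2)[of _ _ _ \<epsilon>])
  then obtain m where m: "\<rho> ^ m * diameter U < \<epsilon>" by (auto simp: eventually_sequentially)
  define b where "b = (diameter U + C ^ 2 * \<epsilon>) / \<kappa> ^ m"
  have diamU: "0 \<le> diameter U" by (rule diameter_ge_0[OF bounded_U])
  show ?thesis
  proof (intro exI conjI allI impI)
    show "0 < b" using diamU C \<epsilon>_pos \<kappa>_pos by (simp add: b_def add_nonneg_pos)
    fix I w assume I: "set I \<subseteq> D" and w: "w \<in> X"
    have wU: "w \<in> U" using w X_U by auto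
    show "diameter (word_map \<phi> I ` X) \<le> b * g I w"
    proof (cases "length I < m")
      case True
      have "\<kappa> ^ m \<le> \<kappa> ^ length I"
        using True \<kappa>_pos \<kappa>_less_1 by (intro power_decreasing) auto
      also have "\<dots> \<le> g I w" by (rule g_bounds(1)[OF I wU])
      finally have 1: "\<kappa> ^ m \<le> g I w" .
      have "diameter (word_map \<phi> I ` X) \<le> diameter U"
        using word_image_subset[OF I] X_U by (intro diameter_subset[OF _ bounded_U]) auto
      also have "\<dots> \<le> diameter U + C ^ 2 * \<epsilon>" using \<epsilon>_pos by simp
      also have "\<dots> = b * \<kappa> ^ m" using \<kappa>_pos by (simp add: b_def)
      also have "\<dots> \<le> b * g I w" by (rule mult_left_mono[OF 1]) (use \<open>0 < b\<close> in simp)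
      finally show ?thesis .
    next
      case False
      define M where "M = take (length I - m) I"
      define L where "L = drop (length I - m) I"
      have IML: "I = M @ L" and lenL: "length L = m"
        using False by (auto simp: M_def L_def)
      have M: "set M \<subseteq> D" and L: "set L \<subseteq> D" using I IML by auto
      have Lw: "word_map \<phi> L w \<in> X" "word_map \<phi> L w \<in> U" using word_map_in_X[OF L w] X_U by auto
      have "g M (word_map \<phi> L w) * \<kappa> ^ m \<le> g M (word_map \<phi> L w) * g L w"
        by (rule mult_left_mono) (use g_bounds(1)[OF L wU] lenL g_pos_U[OF M Lw(2)] in auto)
      also have "\<dots> = g I w" unfolding IML by (rule g_append_U[OF M L wU, symmetric])
      finally have gM: "g M (word_map \<phi> L w) \<le> g I w / \<kappa> ^ m"
        using \<kappa>_pos by (simp add: field_simps)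
      show ?thesis
      proof (rule diameter_le)
        fix p q assume "p \<in> word_map \<phi> I ` X" "q \<in> word_map \<phi> I ` X"
        then obtain x y where x: "x \<in> X" "p = word_map \<phi> M (word_map \<phi> L x)"
          and y: "y \<in> X" "q = word_map \<phi> M (word_map \<phi> L y)"
          by (auto simp: IML word_map_append)
        let ?x = "word_map \<phi> L x" and ?y = "word_map \<phi> L y"
        have x': "?x \<in> X" by (rule word_map_in_X[OF L x(1)])
        have xyU: "x \<in> U" "y \<in> U" using x y X_U by auto
        have "dist ?x ?y \<le> \<rho> ^ m * dist x y" using word_map_contract[OF L xyU] lenL by simp
        also have "\<dots> \<le> \<rho> ^ m * diameter U"
          by (rule mult_left_mono) (use diameter_bounded_bound[OF bounded_U xyU] \<rho> in auto)
        finally have near: "dist ?x ?y < \<epsilon>" using m by simp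
        have "dist p q \<le> (C * g M (word_map \<phi> L w)) * dist ?x ?y"
          unfolding x(2) y(2)
        proof (rule conformal_lipschitz_ball[where R = \<epsilon> and a = "g M"])
          fix z assume "z \<in> ball ?x \<epsilon>"
          then have z: "z \<in> U" using ball_U[OF x'] by blast
          show "conformal_at (word_map \<phi> M) z (g M z)" by (rule word_map_conformal[OF M z])
          show "g M z \<le> C * g M (word_map \<phi> L w)" by (rule g_distortion[OF M z Lw(2)])
        qed (use near in simp)
        also have "\<dots> \<le> (C * g M (word_map \<phi> L w)) * \<epsilon>"
          by (rule mult_left_mono) (use near C g_pos_U[OF M Lw(2)] in auto)
        also have "\<dots> \<le> C * (g I w / \<kappa> ^ m) * \<epsilon>"
          by (intro mult_right_mono mult_left_mono gM) (use C \<epsilon>_pos in auto)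
        also have "\<dots> = (C * \<epsilon>) / \<kappa> ^ m * g I w" by simp
        also have "\<dots> \<le> b * g I w"
        proof (rule mult_right_mono)
          have "C * 1 \<le> C * C" by (rule mult_left_mono) (use C in auto)
          then have "C * \<epsilon> \<le> C ^ 2 * \<epsilon>"
            using \<epsilon>_pos by (intro mult_right_mono) (simp_all add: power2_eq_square)
          then show "C * \<epsilon> / \<kappa> ^ m \<le> b"
            unfolding b_def using diamU \<kappa>_pos by (intro divide_right_mono) auto
        qed (use g_pos_U[OF I wU] in simp)
        finally show "norm (p - q) \<le> b * g I w" by (simp add: dist_norm)
      qed (use X_nonempty in auto)
    qed
  qed
qed

end

section \<open>Exact overlaps\<close>

lemma suminf_ennreal_eq_top_of_lower_bound:
  assumes "0 < c" "\<And>n. ennreal c \<le> f n"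
  shows "(\<Sum>n. f n) = (\<infinity> :: ennreal)"
proof -
  have "(\<Sum>n::nat. ennreal c) = \<infinity>"
    using assms(1) nn_integral_count_space_nat[of "\<lambda>_. ennreal c"]
    by (simp add: ennreal_mult_top)
  moreover have "(\<Sum>n. ennreal c) \<le> (\<Sum>n. f n)" by (rule suminf_le) (use assms in auto)
  ultimately show ?thesis by (simp add: top_unique)
qed

context conformal_neighbourhood
begin

lemma similarity_dim_eqI:
  assumes "1 \<le> K" "\<And>n x. x \<in> X \<Longrightarrow> 1 / K \<le> Z s (words D n) x \<and> Z s (words D n) x \<le> K"
  shows "similarity_dim D \<phi> X = s"
proof -
  have Z: "pressure_sum D \<phi> t n = Z t (words D n)" for t n
    by (simp add: fun_eq_iff pressure_sum_def Z_def g_def)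
  have "has_pressure D \<phi> X s 0"
    unfolding has_pressure_def Z
    by (rule conjI[OF zero_pressure_of_bounds[OF assms(1) assms(2)]])
  moreover have "t = s" if "has_pressure D \<phi> X t 0" for t
    using that unfolding has_pressure_def Z
    by (elim conjE) (rule zero_pressure_unique[OF assms(1) assms(2)])
  ultimately show ?thesis
    unfolding similarity_dim_def by (rule the_equality)
qed

text \<open>
  The choice \<open>\<theta> = 1\<close> satisfies the divergence condition, whereas the limsup set is null for all
  exponents in an interval with right end \<open>d\<close>.
\<close>

lemma overlap_not_regular:
  assumes J: "J \<in> words D k" "J' \<in> words D k" "J' \<noteq> J" and k: "1 \<le> k"
    and eq: "\<And>x. x \<in> X \<Longrightarrow> word_map \<phi> J x = word_map \<phi> J' x"
  shows "\<not> approx_regular_pair D \<phi> X z"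
proof
  assume reg: "approx_regular_pair D \<phi> X z"
  define d where "d = hausdorff_dim X"
  have d: "0 < d" and z: "z \<in> X" using reg by (auto simp: approx_regular_pair_def d_def)
  obtain s K where s: "0 < s" and K: "1 \<le> K"
    and bounds: "\<And>n x. x \<in> X \<Longrightarrow> 1 / K \<le> Z s (words D n) x \<and> Z s (words D n) x \<le> K"
    using critical_exponent_exists by auto
  have dim_S: "similarity_dim D \<phi> X = s" by (rule similarity_dim_eqI[OF K bounds])
  have "X \<noteq> {z}" using d hausdorff_dim_singleton_le[of z] by (auto simp: d_def)
  then obtain y where y: "y \<in> X" "y \<noteq> z" using z by blast
  let ?diam = "\<lambda>I. diameter (word_map \<phi> I ` X)"
  obtain b where b: "0 < b" "\<And>I w. set I \<subseteq> D \<Longrightarrow> w \<in> X \<Longrightarrow> b * g I w \<le> ?diam I"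
    using diameter_lower[OF y(1) z y(2)] by blast
  obtain B where B: "0 < B" "\<And>I w. set I \<subseteq> D \<Longrightarrow> w \<in> X \<Longrightarrow> ?diam I \<le> B * g I w"
    using diameter_upper by blast
  define R where "R = approx_radius D \<phi> X (\<lambda>_. 1)"
  have R: "R I = ?diam I powr (s / d)" for I
    by (simp add: R_def approx_radius_def dim_S d_def)
  have R_powr: "R I powr u = ?diam I powr (s * u / d)" for I u
    by (simp add: R powr_powr)
  define W where "W = limsup_set D \<phi> X R z"
  have "divergence_condition D \<phi> X (\<lambda>_. 1)"
    unfolding divergence_condition_def R_def[symmetric] d_def[symmetric]
  proof (rule suminf_ennreal_eq_top_of_lower_bound)
    show "0 < b powr s * (1 / K)" using b K by simp
    fix n
    have "b powr s * (1 / K) \<le> b powr s * Z s (words D (Suc n)) z"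
      by (rule mult_left_mono) (use bounds[OF z] in auto)
    also have "\<dots> = (\<Sum>I\<in>words D (Suc n). b powr s * g I z powr s)"
      by (simp add: Z_def sum_distrib_left)
    also have "\<dots> \<le> (\<Sum>I\<in>words D (Suc n). R I powr d)"
    proof (rule sum_mono)
      fix I assume "I \<in> words D (Suc n)"
      then have I: "set I \<subseteq> D" by (auto simp: words_def)
      have "b powr s * g I z powr s = (b * g I z) powr s"
        using b g_pos[OF I z] by (simp add: powr_mult)
      also have "\<dots> \<le> ?diam I powr s"
        by (rule powr_mono2) (use s b g_pos[OF I z] b(2)[OF I z] in auto)
      finally show "b powr s * g I z powr s \<le> R I powr d" using d by (simp add: R_powr)
    qed
    finally show "ennreal (b powr s * (1 / K)) \<le> (\<Sum>I\<in>words D (Suc n). ennreal (R I powr d))"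
      by (simp add: sum_ennreal ennreal_leI)
  qed
  then have conclusion: "if hausdorff_measure d X > 0 then hausdorff_measure d (X - W) = 0
      else hausdorff_dim W = d"
    using reg unfolding approx_regular_pair_def Let_def W_def R_def d_def
    by (auto simp: decseq_def dest!: spec[of _ "\<lambda>_. 1"])
  obtain e where e: "0 < e" "e < s"
    and sm: "\<And>t. t \<in> {s - e..s} \<Longrightarrow> summable (\<lambda>n. Z t (representatives k J n) z)"
    using representatives_summable[OF s K bounds J(1) k z] by auto
  \<comment> \<open>A radius to the power \<open>u\<close> is a diameter to the power \<open>s u / d\<close>; this explains the range of \<open>u\<close>.\<close>
  have null: "hausdorff_measure u W = 0" if t: "s * u / d \<in> {s - e..s}" for u
  proof (rule hausdorff_measure_limsup_null)
    define t where "t = s * u / d"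
    have t_pos: "0 < t" using t e by (auto simp: t_def)
    then show "0 < u" using s d by (auto simp: t_def zero_less_divide_iff zero_less_mult_iff)
    show "finite (representatives k J n)" for n
      using finite_subset[OF representatives_subset finite_words[OF finite_D]] .
    show "bounded (cball (word_map \<phi> I z) (R I))" for I by simp
    show "W \<subseteq> (\<Union>n\<in>{N..}. \<Union>I\<in>representatives k J n. cball (word_map \<phi> I z) (R I))" for N
    proof
      fix x assume "x \<in> W"
      then have inf: "infinite {I \<in> all_words D. x \<in> cball (word_map \<phi> I z) (R I)}"
        by (simp add: W_def limsup_set_def)
      have "finite (\<Union>n<N. words D n)" using finite_words[OF finite_D] by simp
      then obtain I where I: "I \<in> all_words D" "x \<in> cball (word_map \<phi> I z) (R I)"
          "I \<notin> (\<Union>n<N. words D n)"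
        using inf by (metis (mono_tags, lifting) finite_subset mem_Collect_eq subsetI)
      define n where "n = length I"
      have In: "I \<in> words D n" using I(1) by (auto simp: all_words_def words_def n_def)
      then have "N \<le> n" using I(3) by (meson UN_I lessThan_iff not_le)
      obtain I' where I': "I' \<in> representatives k J n"
          "\<And>x. x \<in> X \<Longrightarrow> word_map \<phi> I' x = word_map \<phi> I x"
        using representatives_represent[OF J eq In] by blast
      have "word_map \<phi> I' ` X = word_map \<phi> I ` X" using I'(2) by (simp cong: image_cong)
      then have "R I' = R I" by (simp add: R)
      then have "x \<in> cball (word_map \<phi> I' z) (R I')" using I(2) I'(2)[OF z] by simp
      then show "x \<in> (\<Union>n\<in>{N..}. \<Union>I\<in>representatives k J n. cball (word_map \<phi> I z) (R I))"
        using I'(1) \<open>N \<le> n\<close> by blast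
    qed
    show "summable (\<lambda>n. \<Sum>I\<in>representatives k J n. diameter (cball (word_map \<phi> I z) (R I)) powr u)"
    proof (rule summable_comparison_test')
      show "summable (\<lambda>n. 2 powr u * B powr t * Z t (representatives k J n) z)"
        by (intro summable_mult sm) (use t in \<open>simp add: t_def\<close>)
      fix n
      have "(\<Sum>I\<in>representatives k J n. diameter (cball (word_map \<phi> I z) (R I)) powr u)
          \<le> (\<Sum>I\<in>representatives k J n. 2 powr u * B powr t * g I z powr t)"
      proof (rule sum_mono)
        fix I assume "I \<in> representatives k J n"
        then have I: "set I \<subseteq> D" using representatives_subset by (force simp: words_def)
        have "diameter (cball (word_map \<phi> I z) (R I)) powr u = 2 powr u * ?diam I powr t"
          by (simp add: R powr_mult powr_powr t_def not_less)
        also have "\<dots> \<le> 2 powr u * (B * g I z) powr t"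
          by (intro mult_left_mono powr_mono2)
             (use t_pos B(2)[OF I z] diameter_ge_0 bounded_subset[OF bounded_X word_image_subset[OF I]]
              in auto)
        also have "\<dots> = 2 powr u * B powr t * g I z powr t"
          using B g_pos[OF I z] by (simp add: powr_mult)
        finally show "diameter (cball (word_map \<phi> I z) (R I)) powr u
            \<le> 2 powr u * B powr t * g I z powr t" .
      qed
      then show "norm (\<Sum>I\<in>representatives k J n. diameter (cball (word_map \<phi> I z) (R I)) powr u)
          \<le> 2 powr u * B powr t * Z t (representatives k J n) z"
        by (simp add: Z_def sum_distrib_left sum_nonneg)
    qed
  qed
  \<comment> \<open>The smallest exponent in the range.\<close>
  define u where "u = d * (s - e) / s"
  have u: "0 \<le> u" "u < d" using d s e by (auto simp: u_def field_simps)
  have "s * u / d = s - e" using d s by (simp add: u_def)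
  then have "hausdorff_dim W \<le> u" using e by (intro hausdorff_dim_le null u(1)) auto
  moreover have "hausdorff_measure d W = 0" using e d by (intro null) auto
  then have "hausdorff_measure d ((X - W) \<union> W) = 0" if "hausdorff_measure d (X - W) = 0"
    using that hausdorff_measure_null_Un by blast
  then have "hausdorff_measure d X = 0" if "hausdorff_measure d (X - W) = 0"
    using that hausdorff_measure_null_subset[of d "(X - W) \<union> W" X] by blast
  ultimately show False using conclusion u(2) by (auto split: if_splits)
qed

end

lemma finite_uniform_bound:
  fixes a :: "'i \<Rightarrow> real"
  assumes "finite D" "\<And>i. i \<in> D \<Longrightarrow> a i < b"
  shows "\<exists>m<b. \<forall>i\<in>D. a i \<le> m"
proof (intro exI conjI ballI)
  show "Max (insert (b - 1) (a ` D)) < b" using assms by (subst Max_less_iff) auto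
  show "a i \<le> Max (insert (b - 1) (a ` D))" if "i \<in> D" for i
    using assms(1) that by (intro Max_ge) auto
qed

lemma exact_overlap_card:
  assumes "finite D" "I \<in> words D n" "J \<in> words D n" "I \<noteq> J"
  shows "2 \<le> card D"
proof (rule ccontr)
  assume "\<not> 2 \<le> card D"
  then have "x = y" if "x \<in> D" "y \<in> D" for x y
    using card_le_Suc0_iff_eq[OF assms(1)] that by simp
  then have "I ! j = J ! j" if "j < n" for j
    using that assms(2,3) by (metis (mono_tags, lifting) mem_Collect_eq nth_mem subsetD words_def)
  then have "I = J" using assms(2,3) by (intro nth_equalityI) (auto simp: words_def)
  then show False using assms(4) by simp
qed

text \<open>
  \<open>U\<close> is the neighbourhood of \<open>Y\<close> of radius \<open>\<epsilon>\<close>, small enough to lie in \<open>V\<close>; it is invariant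
  because \<open>Y\<close> is and distances to \<open>Y\<close> shrink.
\<close>

lemma conformal_ifs_neighbourhood:
  fixes X Y :: "'a::euclidean_space set"
  assumes ifs: "conformal_ifs D \<phi> Y" and attr: "is_attractor D \<phi> Y X" and card: "2 \<le> card D"
  shows "\<exists>U \<epsilon> \<rho> \<kappa> r c \<alpha>. conformal_neighbourhood D \<phi> X U \<epsilon> \<rho> \<kappa> r c \<alpha>"
proof -
  have fin: "finite D" and cY: "compact Y" and Yinv: "\<And>i x. i \<in> D \<Longrightarrow> x \<in> Y \<Longrightarrow> \<phi> i x \<in> Y"
    using ifs by (auto simp: conformal_ifs_def ifs_def)
  have X: "X \<noteq> {}" "X \<subseteq> Y" "X = (\<Union>i\<in>D. \<phi> i ` X)" using attr by (auto simp: is_attractor_def)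
  obtain V \<alpha> c where V: "open V" "Y \<subseteq> V"
    and maps: "\<forall>i\<in>D. inj_on (\<phi> i) V \<and> contraction_on V (\<phi> i) \<and> conformal_on V (\<phi> i) \<and>
               0 < (INF x\<in>V. deriv_norm (\<phi> i) x) \<and>
               bdd_above (deriv_norm (\<phi> i) ` V) \<and> (SUP x\<in>V. deriv_norm (\<phi> i) x) < 1"
    and \<alpha>: "0 < \<alpha>" and c: "0 < c"
    and hoelder: "\<forall>i\<in>D. \<forall>x\<in>V. \<forall>y\<in>V.
        \<bar>deriv_norm (\<phi> i) x - deriv_norm (\<phi> i) y\<bar> \<le> c * dist x y powr \<alpha>"
    using ifs unfolding conformal_ifs_def by (elim conjE exE) (rule that)
  have inj: "inj_on (\<phi> i) V" and contr: "contraction_on V (\<phi> i)"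
    and conf: "conformal_on V (\<phi> i)" and INF: "0 < (INF x\<in>V. deriv_norm (\<phi> i) x)"
    and bdd: "bdd_above (deriv_norm (\<phi> i) ` V)"
    and SUP: "(SUP x\<in>V. deriv_norm (\<phi> i) x) < 1" if "i \<in> D" for i
    using maps that by simp_all
  obtain \<epsilon> where \<epsilon>: "0 < \<epsilon>" "(\<Union>y\<in>Y. ball y \<epsilon>) \<subseteq> V"
    using compact_subset_open_imp_ball_epsilon_subset[OF cY V] by blast
  define U where "U = (\<Union>y\<in>Y. ball y \<epsilon>)"
  have UV: "U \<subseteq> V" using \<epsilon> by (simp add: U_def)
  obtain \<rho>' where \<rho>': "\<And>i. i \<in> D \<Longrightarrow> \<rho>' i < 1" "\<And>i. i \<in> D \<Longrightarrow> lipschitz_on (\<rho>' i) V (\<phi> i)"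
    using contr unfolding contraction_on_def by metis
  obtain \<rho>0 where \<rho>0: "\<rho>0 < 1" "\<And>i. i \<in> D \<Longrightarrow> \<rho>' i \<le> \<rho>0"
    using finite_uniform_bound[OF fin, of \<rho>' 1] \<rho>'(1) by blast
  \<comment> \<open>The ratio is kept positive so that its powers with real exponents are multiplicative.\<close>
  define \<rho> where "\<rho> = max \<rho>0 (1 / 2)"
  have \<rho>: "0 < \<rho>" "\<rho> < 1" using \<rho>0 by (auto simp: \<rho>_def)
  have contract: "dist (\<phi> i x) (\<phi> i y) \<le> \<rho> * dist x y" if "i \<in> D" "x \<in> V" "y \<in> V" for i x y
  proof -
    have "dist (\<phi> i x) (\<phi> i y) \<le> \<rho>' i * dist x y"
      by (rule lipschitz_onD[OF \<rho>'(2)[OF that(1)] that(2,3)])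
    also have "\<dots> \<le> \<rho> * dist x y"
      by (rule mult_right_mono) (use \<rho>0(2)[OF that(1)] in \<open>auto simp: \<rho>_def\<close>)
    finally show ?thesis .
  qed
  obtain r where r: "r < 1" "\<And>i. i \<in> D \<Longrightarrow> (SUP x\<in>V. deriv_norm (\<phi> i) x) \<le> r"
    using finite_uniform_bound[OF fin, of "\<lambda>i. SUP x\<in>V. deriv_norm (\<phi> i) x" 1] SUP by blast
  obtain \<kappa>' where \<kappa>': "\<kappa>' < 0" "\<And>i. i \<in> D \<Longrightarrow> - (INF x\<in>V. deriv_norm (\<phi> i) x) \<le> \<kappa>'"
    using finite_uniform_bound[OF fin, of "\<lambda>i. - (INF x\<in>V. deriv_norm (\<phi> i) x)" 0] INF by auto
  have conf_at: "conformal_at (\<phi> i) x (deriv_norm (\<phi> i) x)" if "i \<in> D" "x \<in> V" for i x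
    by (rule conformal_on_imp_conformal_at[OF conf]) (use that in auto)
  have lower: "- \<kappa>' \<le> deriv_norm (\<phi> i) x" if i: "i \<in> D" and x: "x \<in> V" for i x
  proof -
    have "bdd_below (deriv_norm (\<phi> i) ` V)"
      using conformal_at_nonneg[OF conf_at[OF i]] by (intro bdd_belowI2[of _ 0])
    then have "(INF x\<in>V. deriv_norm (\<phi> i) x) \<le> deriv_norm (\<phi> i) x"
      by (rule cINF_lower) (rule x)
    then show ?thesis using \<kappa>'(2)[OF i] by linarith
  qed
  have upper: "deriv_norm (\<phi> i) x \<le> r" if i: "i \<in> D" and x: "x \<in> V" for i x
    using cSUP_upper[OF x bdd[OF i]] r(2)[OF i] by linarith
  have "conformal_neighbourhood D \<phi> X U \<epsilon> \<rho> (- \<kappa>') r c \<alpha>"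
  proof
    obtain M where "\<And>y. y \<in> Y \<Longrightarrow> norm y \<le> M"
      using compact_imp_bounded[OF cY] by (auto simp: bounded_iff)
    moreover have "norm x \<le> norm y + dist y x" for x y :: 'a
      using norm_triangle_sub[of x y] by (simp add: dist_norm norm_minus_commute)
    ultimately have "norm x \<le> M + \<epsilon>" if "x \<in> U" for x
      using that unfolding U_def by (smt (verit) UN_E mem_ball)
    then show "bounded U" by (auto simp: bounded_iff)
    show "ball x \<epsilon> \<subseteq> U" if "x \<in> X" for x using that X(2) by (auto simp: U_def)
    show "\<phi> i x \<in> X" if "i \<in> D" "x \<in> X" for i x using that X(3) by blast
    show "\<phi> i x \<in> U" if i: "i \<in> D" and x: "x \<in> U" for i x
    proof -
      obtain y where y: "y \<in> Y" "dist y x < \<epsilon>" using x by (auto simp: U_def)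
      have "dist (\<phi> i y) (\<phi> i x) \<le> \<rho> * dist y x" using contract i x y V UV by blast
      also have "\<dots> \<le> 1 * dist y x" by (rule mult_right_mono) (use \<rho> in auto)
      finally show ?thesis using Yinv[OF i y(1)] y(2) by (force simp: U_def)
    qed
    show "inj_on (\<phi> i) U" if "i \<in> D" for i using inj_on_subset[OF inj[OF that] UV] .
    show "deriv_norm (\<phi> i) x \<le> deriv_norm (\<phi> i) y + c * dist x y powr \<alpha>"
      if "i \<in> D" "x \<in> U" "y \<in> U" for i x y
    proof -
      have "\<bar>deriv_norm (\<phi> i) x - deriv_norm (\<phi> i) y\<bar> \<le> c * dist x y powr \<alpha>"
        using hoelder that UV by blast
      then show ?thesis by linarith
    qed
    show "- \<kappa>' \<le> deriv_norm (\<phi> i) x" "deriv_norm (\<phi> i) x \<le> r"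
      "conformal_at (\<phi> i) x (deriv_norm (\<phi> i) x)" if "i \<in> D" "x \<in> U" for i x
      using that UV lower upper conf_at by auto
    show "dist (\<phi> i x) (\<phi> i y) \<le> \<rho> * dist x y" if "i \<in> D" "x \<in> U" "y \<in> U" for i x y
      by (rule contract) (use that UV in auto)
  qed (use fin card X(1) \<epsilon>(1) \<rho> \<kappa>'(1) r(1) c \<alpha> in auto)
  then show ?thesis by blast
qed

theorem theorem6p1:
  fixes D :: "'i set"
    and \<phi> :: "'i \<Rightarrow> 'a \<Rightarrow> 'a::euclidean_space"
    and X Y :: "'a set"
  assumes "conformal_ifs D \<phi> Y"
    and "is_attractor D \<phi> Y X"
    and "exact_overlap D \<phi> Y"
  shows "\<forall>z\<in>X. \<not> approx_regular_pair D \<phi> X z"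
proof -
  obtain k I J where k: "1 \<le> k" and IJ: "I \<in> words D k" "J \<in> words D k" "J \<noteq> I"
    and eq: "\<And>x. x \<in> Y \<Longrightarrow> word_map \<phi> I x = word_map \<phi> J x"
    using assms(3) unfolding exact_overlap_def by metis
  have "finite D" using assms(1) by (auto simp: conformal_ifs_def ifs_def)
  then have "2 \<le> card D" using exact_overlap_card IJ by metis
  then obtain U \<epsilon> \<rho> \<kappa> r c \<alpha> where "conformal_neighbourhood D \<phi> X U \<epsilon> \<rho> \<kappa> r c \<alpha>"
    using conformal_ifs_neighbourhood[OF assms(1,2)] by blast
  then interpret conformal_neighbourhood D \<phi> X U \<epsilon> \<rho> \<kappa> r c \<alpha> .
  have "X \<subseteq> Y" using assms(2) by (simp add: is_attractor_def)
  then show ?thesis using overlap_not_regular[OF IJ k] eq by blast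
qed

end
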